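(* Let $E$ be a countable Borel equivalence relation on a standard Borel space $X$, and let $G$ be a Borel median graphing of $E$ with finite hyperplanes. Then $G$ has a Borel subtreeing: there is an acyclic Borel graph $T\subseteq G$ whose connectedness relation is $E$.
   Context: A countable Borel equivalence relation (CBER) is a Borel equivalence relation with countable classes. A graph is a symmetric irreflexive relation. A Borel graphing of $E$ is a Borel graph $G\subseteq X^2$ whose connectedness relation is exactly $E$; it is a median graphing if every component is a median graph. For a connected graph with path metric $d$, the interval $[x,y]$ is $\{z: d(x,z)+d(z,y)=d(x,y)\}$. A median graph is a connected graph such that for all vertices $x,y,z$ the set $[x,y]\cap[y,z]\cap[z,x]$ is a singleton. A set $A$ of vertices is convex if $[x,y]\subseteq A$ for all $x,y\in A$. A half-space is a convex set $H$ with convex complement. A hyperplane is the set of (oriented) edges $(x,y)$ with $x\notin H\ni y$, for a half-space $H$ different from $\emptyset$ and the whole vertex set. "Finite hyperplanes" means every hyperplane of every component is a finite set of edges. $G$ is not assumed locally finite. *)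

theory Defs
  imports "HOL-Analysis.Analysis"
begin

text \<open>A measurable space is given by the underlying space and \<open>\<sigma>\<close>-algebra of an Isabelle
  measure; the values of the measure play no role.\<close>

definition standard_borel_space :: "'a measure \<Rightarrow> bool" where
  "standard_borel_space M \<longleftrightarrow>
     (\<exists>\<tau>. completely_metrizable_space \<tau> \<and> separable_space \<tau> \<and> topspace \<tau> = space M \<and>
          sets M = sigma_sets (space M) {U. openin \<tau> U})"

definition cber :: "'a measure \<Rightarrow> ('a \<times> 'a) set \<Rightarrow> bool" where
  "cber M E \<longleftrightarrow> equiv (space M) E \<and> E \<in> sets (M \<Otimes>\<^sub>M M) \<and> (\<forall>C \<in> space M // E. countable C)"

definition graph_on :: "'a set \<Rightarrow> ('a \<times> 'a) set \<Rightarrow> bool" where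
  "graph_on V G \<longleftrightarrow> G \<subseteq> V \<times> V \<and> sym G \<and> irrefl G"

definition connectedness :: "'a set \<Rightarrow> ('a \<times> 'a) set \<Rightarrow> ('a \<times> 'a) set" where
  "connectedness V G = {(x, y). x \<in> V \<and> y \<in> V \<and> (x, y) \<in> G\<^sup>*}"

definition connected_graph :: "'a set \<Rightarrow> ('a \<times> 'a) set \<Rightarrow> bool" where
  "connected_graph V G \<longleftrightarrow> graph_on V G \<and> connectedness V G = V \<times> V"

definition components :: "'a set \<Rightarrow> ('a \<times> 'a) set \<Rightarrow> 'a set set" where
  "components V G = V // connectedness V G"

text \<open>The path metric; it is meaningful only for vertices joined by a path, and is used below
  only within connected graphs.\<close>

definition path_dist :: "('a \<times> 'a) set \<Rightarrow> 'a \<Rightarrow> 'a \<Rightarrow> nat" where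
  "path_dist G x y = (LEAST n. (x, y) \<in> G ^^ n)"

definition interval_in :: "'a set \<Rightarrow> ('a \<times> 'a) set \<Rightarrow> 'a \<Rightarrow> 'a \<Rightarrow> 'a set" where
  "interval_in V G x y = {z \<in> V. path_dist G x z + path_dist G z y = path_dist G x y}"

definition median_graph :: "'a set \<Rightarrow> ('a \<times> 'a) set \<Rightarrow> bool" where
  "median_graph V G \<longleftrightarrow> connected_graph V G \<and>
     (\<forall>x\<in>V. \<forall>y\<in>V. \<forall>z\<in>V.
        is_singleton (interval_in V G x y \<inter> interval_in V G y z \<inter> interval_in V G z x))"

definition convex_in :: "'a set \<Rightarrow> ('a \<times> 'a) set \<Rightarrow> 'a set \<Rightarrow> bool" where
  "convex_in V G A \<longleftrightarrow> A \<subseteq> V \<and> (\<forall>x\<in>A. \<forall>y\<in>A. interval_in V G x y \<subseteq> A)"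

definition half_space :: "'a set \<Rightarrow> ('a \<times> 'a) set \<Rightarrow> 'a set \<Rightarrow> bool" where
  "half_space V G H \<longleftrightarrow> convex_in V G H \<and> convex_in V G (V - H)"

definition hyperplanes :: "'a set \<Rightarrow> ('a \<times> 'a) set \<Rightarrow> ('a \<times> 'a) set set" where
  "hyperplanes V G =
     {{(x, y) \<in> G. x \<notin> H \<and> y \<in> H} | H. half_space V G H \<and> H \<noteq> {} \<and> H \<noteq> V}"

definition finite_hyperplanes :: "'a set \<Rightarrow> ('a \<times> 'a) set \<Rightarrow> bool" where
  "finite_hyperplanes V G \<longleftrightarrow>
     (\<forall>C \<in> components V G. \<forall>h \<in> hyperplanes C (Restr G C). finite h)"

text \<open>Acyclicity of undirected graphs. The library's \<^const>\<open>acyclic\<close> forbids directed cycles and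
  so fails for every symmetric relation with an edge.\<close>

definition graph_cycle :: "('a \<times> 'a) set \<Rightarrow> 'a list \<Rightarrow> bool" where
  "graph_cycle G p \<longleftrightarrow> 3 \<le> length p \<and> distinct p \<and>
     (\<forall>i < length p. (p ! i, p ! (Suc i mod length p)) \<in> G)"

definition acyclic_graph :: "('a \<times> 'a) set \<Rightarrow> bool" where
  "acyclic_graph G \<longleftrightarrow> (\<nexists>p. graph_cycle G p)"

definition borel_graph :: "'a measure \<Rightarrow> ('a \<times> 'a) set \<Rightarrow> bool" where
  "borel_graph M G \<longleftrightarrow> graph_on (space M) G \<and> G \<in> sets (M \<Otimes>\<^sub>M M)"

definition borel_graphing :: "'a measure \<Rightarrow> ('a \<times> 'a) set \<Rightarrow> ('a \<times> 'a) set \<Rightarrow> bool" where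
  "borel_graphing M E G \<longleftrightarrow> borel_graph M G \<and> connectedness (space M) G = E"

definition median_graphing :: "'a measure \<Rightarrow> ('a \<times> 'a) set \<Rightarrow> ('a \<times> 'a) set \<Rightarrow> bool" where
  "median_graphing M E G \<longleftrightarrow> borel_graphing M E G \<and>
     (\<forall>C \<in> components (space M) G. median_graph C (Restr G C))"

end

theory Submission
  imports Defs
begin

text \<open>
  A hyperplane is finite, hence crossed by only finitely many others, so the hyperplanes admit a
  Borel colouring by natural numbers in which crossing hyperplanes have different colours. Write
  \<open>x \<sim>\<^sub>n y\<close> if every hyperplane separating \<open>x\<close> from \<open>y\<close> has colour below \<open>n\<close>; these relations
  increase to \<open>E\<close>. A class of \<open>\<sim>\<^sub>n\<^sub>+\<^sub>1\<close> is cut by pairwise nested hyperplanes of colour \<open>n\<close> into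
  classes of \<open>\<sim>\<^sub>n\<close> arranged as a tree, so keeping exactly one edge of each of these hyperplanes turns
  trees on the classes of \<open>\<sim>\<^sub>n\<close> into trees on the classes of \<open>\<sim>\<^sub>n\<^sub>+\<^sub>1\<close>.

  Every quantifier in this construction ranges over a single class of \<open>E\<close>, so it is Borel by the
  Lusin--Novikov theorem: a Borel set with countable sections is covered by the graphs of countably
  many Borel functions. As a cover by graphs of total functions suffices, only Lusin separation is
  needed for its proof.
\<close>

section \<open>Analytic sets over the Baire space\<close>

text \<open>Why one edge is enough: two endpoints of edges of a hyperplane that lie on the same side
  of it can be separated only by hyperplanes crossing it, hence of other colours. If the hyperplane
  has colour n and these endpoints are related at level n+1, they are therefore already related at
  level n, and any single edge joins the two classes concerned. A hyperplane may run through several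
  classes of level n+1, so one edge is kept for each class that it meets. The edge must be chosen in
  a Borel way. Edges are compared lexicographically through codes of their ends in the Baire space;
  this order is not well-founded, and it is the finiteness of hyperplanes that provides a least
  edge.\<close>

type_synonym baire = "nat \<Rightarrow> nat"

definition pre :: "nat \<Rightarrow> baire \<Rightarrow> nat list" where
  "pre n \<alpha> = map \<alpha> [0..<n]"

definition cyl :: "nat list \<Rightarrow> baire set" where
  "cyl s = {\<alpha>. pre (length s) \<alpha> = s}"

text \<open>\<open>merge\<close> packs a sequence of points into one point and \<open>col\<close>
  reads off its entries, so that tuples of points, and Borel conditions on them, stay inside the
  Baire space.\<close>

definition col :: "nat \<Rightarrow> baire \<Rightarrow> baire" where
  "col n \<alpha> = (\<lambda>k. \<alpha> (prod_encode (n, k)))"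

definition merge :: "(nat \<Rightarrow> baire) \<Rightarrow> baire" where
  "merge z = (\<lambda>m. z (fst (prod_decode m)) (snd (prod_decode m)))"

text \<open>Allowing any closed parameter set \<open>K\<close> admits the empty set, and imposing a
  closed condition only shrinks \<open>K\<close>.\<close>

definition analytic :: "'b::topological_space set \<Rightarrow> bool" where
  "analytic A \<longleftrightarrow> (\<exists>(K :: baire set) f. closed K \<and> continuous_on K f \<and> A = f ` K)"

lemma length_pre [simp]: "length (pre n \<alpha>) = n"
  by (simp add: pre_def)

lemma pre_eq_iff: "pre n \<alpha> = pre n \<beta> \<longleftrightarrow> (\<forall>i<n. \<alpha> i = \<beta> i)"
  by (auto simp: pre_def)

lemma mem_cyl_pre: "\<beta> \<in> cyl (pre n \<alpha>) \<longleftrightarrow> (\<forall>i<n. \<beta> i = \<alpha> i)"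
  by (simp add: cyl_def pre_eq_iff)

lemma cyl_conv: "cyl s = {\<alpha>. \<forall>i<length s. \<alpha> i = s ! i}"
proof -
  have "pre (length s) \<alpha> = s \<longleftrightarrow> (\<forall>i<length s. \<alpha> i = s ! i)" for \<alpha>
    by (subst list_eq_iff_nth_eq) (simp add: pre_def)
  then show ?thesis by (simp add: cyl_def)
qed

lemma cyl_Nil [simp]: "cyl [] = UNIV"
  by (simp add: cyl_conv)

lemma cyl_UN_snoc: "cyl s = (\<Union>k. cyl (s @ [k]))"
  by (auto simp: cyl_conv nth_append less_Suc_eq)

lemma col_merge [simp]: "col n (merge z) = z n"
  by (simp add: col_def merge_def)

lemma continuous_on_coord [continuous_intros]: "continuous_on S (\<lambda>\<alpha>::baire. \<alpha> i)"
  by (rule continuous_on_subset[OF continuous_on_product_coordinates]) simp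

lemma continuous_on_col [continuous_intros]: "continuous_on S (col n)"
  unfolding col_def by (intro continuous_on_coordinatewise_then_product continuous_on_coord)

lemma clopen_coord:
  shows open_coord: "open {\<alpha>::baire. \<alpha> i \<in> N}" and closed_coord: "closed {\<alpha>::baire. \<alpha> i \<in> N}"
proof -
  have "open {\<alpha>::baire. \<alpha> i \<in> N}" for N
    using open_vimage[OF open_discrete continuous_on_coord[of UNIV i], of N] by (simp add: vimage_def)
  from this[of N] this[of "- N"] show "open {\<alpha>::baire. \<alpha> i \<in> N}" "closed {\<alpha>::baire. \<alpha> i \<in> N}"
    by (auto simp: closed_def Collect_neg_eq[symmetric])
qed

lemma closed_cyl: "closed (cyl s)"
proof -
  have "cyl s = (\<Inter>i<length s. {\<alpha>. \<alpha> i \<in> {s ! i}})" by (auto simp: cyl_conv)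
  then show ?thesis by (simp only:) (intro closed_INT ballI closed_coord)
qed

lemma open_contains_cyl:
  assumes "open U" "\<alpha> \<in> U"
  obtains n where "cyl (pre n \<alpha>) \<subseteq> U"
proof -
  have "openin (product_topology (\<lambda>_. euclidean) UNIV) U"
    using assms(1) by (simp add: open_fun_def)
  from product_topology_open_contains_basis[OF this assms(2)] obtain X :: "nat \<Rightarrow> nat set"
    where X: "\<alpha> \<in> Pi\<^sub>E UNIV X" "finite {i. X i \<noteq> UNIV}" "Pi\<^sub>E UNIV X \<subseteq> U"
    by auto
  obtain n where n: "\<And>i. X i \<noteq> UNIV \<Longrightarrow> i < n"
    using X(2) unfolding finite_nat_set_iff_bounded by auto
  have "cyl (pre n \<alpha>) \<subseteq> Pi\<^sub>E UNIV X"
  proof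
    fix \<beta> assume "\<beta> \<in> cyl (pre n \<alpha>)"
    then have eq: "\<And>i. i < n \<Longrightarrow> \<beta> i = \<alpha> i" by (simp add: mem_cyl_pre)
    have "\<beta> i \<in> X i" for i
      using n[of i] eq[of i] X(1) by (cases "X i = UNIV") (auto simp: PiE_def Pi_def)
    then show "\<beta> \<in> Pi\<^sub>E UNIV X" by auto
  qed
  from order_trans[OF this X(3)] show ?thesis by (rule that)
qed

lemma cyl_limit:
  assumes "\<And>n. z n \<in> cyl (pre n \<alpha>)"
  shows "z \<longlonglongrightarrow> \<alpha>"
proof (rule topological_tendstoI)
  fix U assume "open U" "\<alpha> \<in> U"
  then obtain n where n: "cyl (pre n \<alpha>) \<subseteq> U" by (rule open_contains_cyl)
  have "z m \<in> U" if "m \<ge> n" for m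
    using assms[of m] n that by (force simp: mem_cyl_pre)
  then show "eventually (\<lambda>m. z m \<in> U) sequentially"
    by (auto simp: eventually_sequentially)
qed

lemma closed_limit_cyl:
  assumes "closed K" "\<And>n. K \<inter> cyl (pre n \<alpha>) \<noteq> {}"
  shows "\<alpha> \<in> K"
proof -
  have "\<forall>n. \<exists>y. y \<in> K \<inter> cyl (pre n \<alpha>)" using assms(2) by blast
  then obtain z where "\<forall>n. z n \<in> K \<inter> cyl (pre n \<alpha>)" by (rule choice[THEN exE])
  then show ?thesis using closed_sequentially[OF assms(1), of z \<alpha>] cyl_limit[of z \<alpha>] by auto
qed

lemma continuous_on_cyl_image:
  assumes "continuous_on K f" "\<alpha> \<in> K" "open U" "f \<alpha> \<in> U"
  obtains n where "f ` (K \<inter> cyl (pre n \<alpha>)) \<subseteq> U"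
proof -
  from assms obtain A where A: "open A" "\<alpha> \<in> A" "\<And>y. y \<in> K \<Longrightarrow> y \<in> A \<Longrightarrow> f y \<in> U"
    unfolding continuous_on_topological by metis
  from A(1,2) obtain n where "cyl (pre n \<alpha>) \<subseteq> A" by (rule open_contains_cyl)
  then show ?thesis using A(3) that[of n] by blast
qed

section \<open>Closure properties of analytic sets\<close>

lemma analytic_image:
  assumes "analytic A" "continuous_on A g"
  shows "analytic (g ` A)"
proof -
  obtain K :: "baire set" and f where K: "closed K" "continuous_on K f" "A = f ` K"
    using assms(1) by (auto simp: analytic_def)
  have "continuous_on K (g \<circ> f)"
    by (rule continuous_on_compose[OF K(2)]) (use assms(2) K(3) in simp)
  moreover have "g ` A = (g \<circ> f) ` K" by (simp add: K(3) image_comp)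
  ultimately show ?thesis using K(1) by (auto simp: analytic_def)
qed

lemma analytic_Int_closed:
  assumes "analytic A" "closed C"
  shows "analytic (A \<inter> C)"
proof -
  obtain K :: "baire set" and f where K: "closed K" "continuous_on K f" "A = f ` K"
    using assms(1) by (auto simp: analytic_def)
  have "closed (f -` C \<inter> K)"
    using continuous_on_closed_vimage K assms(2) by blast
  moreover have "A \<inter> C = f ` (f -` C \<inter> K)" using K(3) by auto
  moreover have "continuous_on (f -` C \<inter> K) f" using K(2) by (rule continuous_on_subset) auto
  ultimately show ?thesis by (auto simp: analytic_def)
qed

text \<open>The first coordinate of the parameter says which \<open>A n\<close> is meant, and the
  others form a parameter for it. Fixing a coordinate is a clopen condition, so the pieces glue
  continuously.\<close>

lemma analytic_UN:
  fixes A :: "nat \<Rightarrow> 'b::topological_space set"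
  assumes "\<And>n. analytic (A n)"
  shows "analytic (\<Union>n. A n)"
proof -
  obtain K f where K: "\<And>n. closed (K n :: baire set)" "\<And>n. continuous_on (K n) (f n)"
    "\<And>n. A n = f n ` K n"
    using assms unfolding analytic_def by metis
  define sh :: "baire \<Rightarrow> baire" where "sh \<alpha> = (\<lambda>i. \<alpha> (Suc i))" for \<alpha>
  have sh: "continuous_on S sh" for S
    unfolding sh_def by (intro continuous_on_coordinatewise_then_product continuous_on_coord)
  define L where "L = {\<alpha>. sh \<alpha> \<in> K (\<alpha> 0)}"
  define g where "g \<alpha> = f (\<alpha> 0) (sh \<alpha>)" for \<alpha>
  have shK: "closed (sh -` K n)" for n
    using closed_vimage[OF K(1) sh] .
  have "- L = (\<Union>n. {\<alpha>. \<alpha> 0 \<in> {n}} \<inter> - (sh -` K n))" by (auto simp: L_def)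
  moreover have "open \<dots>"
    using shK by (intro open_UN ballI open_Int open_coord) (auto simp: open_Compl)
  ultimately have "closed L" by (simp add: closed_def)
  moreover have "continuous_on L g"
  proof -
    have n: "continuous_on {\<alpha>\<in>L. \<alpha> 0 = n} g" for n
    proof -
      have "continuous_on {\<alpha>\<in>L. \<alpha> 0 = n} (\<lambda>\<alpha>. f n (sh \<alpha>))"
        by (rule continuous_on_compose2[OF K(2) sh]) (auto simp: L_def)
      then show ?thesis
        by (rule continuous_on_eq) (auto simp: g_def)
    qed
    show ?thesis
      unfolding continuous_on_topological
    proof (intro ballI allI impI)
      fix \<alpha> B assume "\<alpha> \<in> L" "open B" "g \<alpha> \<in> B"
      then obtain U where "open U" "\<alpha> \<in> U" "\<forall>\<beta>\<in>{\<beta>\<in>L. \<beta> 0 = \<alpha> 0}. \<beta> \<in> U \<longrightarrow> g \<beta> \<in> B"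
        using n[of "\<alpha> 0"] unfolding continuous_on_topological by blast
      then show "\<exists>U. open U \<and> \<alpha> \<in> U \<and> (\<forall>\<beta>\<in>L. \<beta> \<in> U \<longrightarrow> g \<beta> \<in> B)"
        using open_coord[of 0 "{\<alpha> 0}"]
        by (intro exI[of _ "U \<inter> {\<beta>. \<beta> 0 \<in> {\<alpha> 0}}"]) auto
    qed
  qed
  moreover have "(\<Union>n. A n) = g ` L"
  proof
    show "g ` L \<subseteq> (\<Union>n. A n)" by (auto simp: g_def L_def K(3))
    show "(\<Union>n. A n) \<subseteq> g ` L"
    proof
      fix y assume "y \<in> (\<Union>n. A n)"
      then obtain n \<alpha> where "\<alpha> \<in> K n" "y = f n \<alpha>" by (auto simp: K(3))
      then have "case_nat n \<alpha> \<in> L" "y = g (case_nat n \<alpha>)" by (auto simp: L_def g_def sh_def)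
      then show "y \<in> g ` L" by blast
    qed
  qed
  ultimately show ?thesis by (auto simp: analytic_def)
qed

text \<open>A parameter packs one parameter for each \<open>A n\<close>; demanding that they all
  name the same point is a closed condition.\<close>

lemma analytic_INT:
  fixes A :: "nat \<Rightarrow> baire set"
  assumes "\<And>n. analytic (A n)"
  shows "analytic (\<Inter>n. A n)"
proof -
  obtain K f where K: "\<And>n. closed (K n :: baire set)" "\<And>n. continuous_on (K n) (f n)"
    "\<And>n. A n = f n ` K n"
    using assms unfolding analytic_def by metis
  define C where "C = (\<Inter>n. col n -` K n)"
  have colK: "closed (col n -` K n)" for n
    using closed_vimage[OF K(1) continuous_on_col] .
  have C: "closed C" unfolding C_def using colK by blast
  have cont: "continuous_on C (\<lambda>\<alpha>. f n (col n \<alpha>))" for n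
    by (rule continuous_on_compose2[OF K(2) continuous_on_col]) (auto simp: C_def)
  define L where "L = (\<Inter>n. {\<alpha>\<in>C. f n (col n \<alpha>) = f 0 (col 0 \<alpha>)})"
  have "closed {\<alpha>\<in>C. f n (col n \<alpha>) = f 0 (col 0 \<alpha>)}" for n
  proof -
    define g where "g = (\<lambda>\<alpha>. (f n (col n \<alpha>), f 0 (col 0 \<alpha>)))"
    have "continuous_on C g" unfolding g_def by (intro continuous_on_Pair cont)
    moreover have "closed {p :: baire \<times> baire. fst p i = snd p i}" for i
    proof -
      have "continuous_on UNIV (\<lambda>p :: baire \<times> baire. fst p i)" "continuous_on UNIV (\<lambda>p :: baire \<times> baire. snd p i)"
        by (rule continuous_on_compose2[OF continuous_on_coord[of UNIV i]]; auto intro: continuous_intros)+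
      then show ?thesis by (rule closed_Collect_eq)
    qed
    then have "closed (\<Inter>i. {p :: baire \<times> baire. fst p i = snd p i})" by blast
    ultimately have "closed (g -` (\<Inter>i. {p. fst p i = snd p i}) \<inter> C)"
      using continuous_on_closed_vimage[OF C, of g] by blast
    moreover have "\<dots> = {\<alpha>\<in>C. f n (col n \<alpha>) = f 0 (col 0 \<alpha>)}"
      by (auto simp: g_def fun_eq_iff)
    ultimately show ?thesis by simp
  qed
  then have "closed L" unfolding L_def by blast
  moreover have "continuous_on L (\<lambda>\<alpha>. f 0 (col 0 \<alpha>))"
    by (rule continuous_on_subset[OF cont]) (auto simp: L_def)
  moreover have "(\<Inter>n. A n) = (\<lambda>\<alpha>. f 0 (col 0 \<alpha>)) ` L"
  proof
    show "(\<lambda>\<alpha>. f 0 (col 0 \<alpha>)) ` L \<subseteq> (\<Inter>n. A n)"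
    proof clarify
      fix \<alpha> n assume \<alpha>: "\<alpha> \<in> L"
      then have "f 0 (col 0 \<alpha>) = f n (col n \<alpha>)" "col n \<alpha> \<in> K n"
        unfolding L_def C_def by (blast intro: sym)+
      then show "f 0 (col 0 \<alpha>) \<in> A n" by (auto simp: K(3))
    qed
    show "(\<Inter>n. A n) \<subseteq> (\<lambda>\<alpha>. f 0 (col 0 \<alpha>)) ` L"
    proof
      fix y assume "y \<in> (\<Inter>n. A n)"
      then have "\<forall>n. \<exists>\<alpha>. \<alpha> \<in> K n \<and> y = f n \<alpha>" by (auto simp: K(3))
      then obtain z where "\<And>n. z n \<in> K n" "\<And>n. y = f n (z n)" by metis
      then have "merge z \<in> L" "y = f 0 (col 0 (merge z))" by (auto simp: L_def C_def)
      then show "y \<in> (\<lambda>\<alpha>. f 0 (col 0 \<alpha>)) ` L" by blast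
    qed
  qed
  ultimately show ?thesis by (auto simp: analytic_def)
qed

lemma analytic_closed: "closed K \<Longrightarrow> analytic (K :: baire set)"
  unfolding analytic_def by (rule exI[of _ K], rule exI[of _ id]) auto

section \<open>Borel sets of the Baire space\<close>

lemma sets_borel_baire: "sets (borel :: baire measure) = sets (Pi\<^sub>M UNIV (\<lambda>_. count_space UNIV))"
proof -
  have "sets (borel :: baire measure) = sets (Pi\<^sub>M UNIV (\<lambda>_. borel))"
    by (rule sets_PiM_equal_borel[symmetric])
  also have "\<dots> = sets (Pi\<^sub>M UNIV (\<lambda>_. count_space UNIV))"
    by (intro sets_PiM_cong) (auto simp: sets_borel_eq_count_space)
  finally show ?thesis .
qed

lemma measurable_baireI:
  assumes "\<And>i. (\<lambda>x. f x i) \<in> M \<rightarrow>\<^sub>M count_space UNIV"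
  shows "f \<in> M \<rightarrow>\<^sub>M (borel :: baire measure)"
proof -
  have "f \<in> M \<rightarrow>\<^sub>M Pi\<^sub>M UNIV (\<lambda>_. count_space UNIV)"
    using measurable_PiM_single'[of UNIV "\<lambda>i x. f x i" M "\<lambda>_. count_space UNIV"] assms
    by (auto simp: space_PiM PiE_def)
  then show ?thesis using measurable_cong_sets[OF refl sets_borel_baire] by blast
qed

lemma measurable_coord [measurable]:
  "(\<lambda>\<alpha>::baire. \<alpha> i) \<in> borel \<rightarrow>\<^sub>M count_space UNIV"
  using borel_measurable_continuous_onI[OF continuous_on_coord[of UNIV i]]
    measurable_cong_sets[OF refl sets_borel_eq_count_space] by blast

lemma sigma_generated_by_coords:
  "sets (borel :: baire measure) = sigma_sets UNIV {{\<alpha>. \<alpha> i \<in> N} | i N. True}" (is "_ = sigma_sets UNIV ?G")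
proof
  show "sigma_sets UNIV ?G \<subseteq> sets (borel :: baire measure)"
    using sets.sigma_sets_subset[of ?G "borel :: baire measure"] borel_open[OF open_coord]
    by (simp only: space_borel) blast
  show "sets (borel :: baire measure) \<subseteq> sigma_sets UNIV ?G"
  proof -
    have "(\<lambda>x. x) \<in> sigma UNIV ?G \<rightarrow>\<^sub>M (borel :: baire measure)"
    proof (rule measurable_baireI)
      fix i
      show "(\<lambda>x::baire. x i) \<in> sigma UNIV ?G \<rightarrow>\<^sub>M count_space UNIV"
        by (rule measurableI) (auto simp: vimage_def intro!: sigma_sets.Basic)
    qed
    then show ?thesis by (auto simp: measurable_def)
  qed
qed

lemma borel_imp_analytic:
  assumes "A \<in> sets (borel :: baire measure)"
  shows "analytic A"
proof -
  have "A \<in> sigma_sets UNIV {{\<alpha>. \<alpha> i \<in> N} | i N. True}"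
    using assms by (simp add: sigma_generated_by_coords)
  \<comment> \<open>Analytic sets are not closed under complements, so the induction carries the
    complement along.\<close>
  then have "analytic A \<and> analytic (- A)"
  proof induction
    case (Basic a)
    then obtain i N where a: "a = {\<alpha>. \<alpha> i \<in> N}" by auto
    show ?case using analytic_closed[OF closed_coord, of i N] analytic_closed[OF closed_coord, of i "- N"]
      by (simp add: a Collect_neg_eq)
  next
    case Empty
    show ?case using analytic_closed[of "{}"] analytic_closed[of UNIV] by simp
  next
    case (Compl a)
    then show ?case by (simp add: Compl_eq_Diff_UNIV[symmetric])
  next
    case (Union a)
    then show ?case using analytic_UN[of a] analytic_INT[of "\<lambda>n. - a n"] by simp
  qed
  then show ?thesis ..
qed

section \<open>Lusin separation and the Lusin--Novikov theorem\<close>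

definition borel_separated :: "baire set \<Rightarrow> baire set \<Rightarrow> bool" where
  "borel_separated A B \<longleftrightarrow> (\<exists>C \<in> sets borel. A \<subseteq> C \<and> B \<inter> C = {})"

text \<open>With \<open>C i j\<close> separating \<open>A i\<close> from \<open>B j\<close>, the
  points that for some \<open>i\<close> lie in all \<open>C i j\<close> form the required
  set.\<close>

lemma borel_separated_UN:
  fixes A B :: "nat \<Rightarrow> baire set"
  assumes "\<And>i j. borel_separated (A i) (B j)"
  shows "borel_separated (\<Union>i. A i) (\<Union>j. B j)"
proof -
  have "\<forall>i. \<exists>C. \<forall>j. C j \<in> sets borel \<and> A i \<subseteq> C j \<and> B j \<inter> C j = {}"
    using assms unfolding borel_separated_def by meson
  then obtain C where C: "\<And>i j. C i j \<in> sets borel" "\<And>i j. A i \<subseteq> C i j" "\<And>i j. B j \<inter> C i j = {}"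
    by metis
  have "(\<Union>i. \<Inter>j. C i j) \<in> sets borel" using C(1) by (intro sets.countable_UN' sets.countable_INT') auto
  moreover have "(\<Union>i. A i) \<subseteq> (\<Union>i. \<Inter>j. C i j)" using C(2) by blast
  moreover have "(\<Union>j. B j) \<inter> (\<Union>i. \<Inter>j. C i j) = {}" using C(3) by blast
  ultimately show ?thesis unfolding borel_separated_def by blast
qed

text \<open>Words may grow by any nonempty amount, since \<open>split_config\<close> lengthens them
  without control; the bound \<open>n \<le> length (s n)\<close> still makes the cylinders shrink to
  the branch.\<close>

lemma chain_limit:
  assumes "\<And>n. \<exists>w. w \<noteq> [] \<and> s (Suc n) = s n @ w"
  obtains \<alpha> where "\<And>n. \<alpha> \<in> cyl (s n)" "\<And>n. n \<le> length (s n)"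
proof -
  have len: "n \<le> length (s n)" for n
  proof (induction n)
    case (Suc n)
    obtain w where "w \<noteq> []" "s (Suc n) = s n @ w" using assms[of n] by blast
    then show ?case using Suc by (cases w) auto
  qed simp
  have ext: "\<exists>w. s (n + k) = s n @ w" for n k
  proof (induction k)
    case (Suc k)
    then show ?case using assms[of "n + k"] by (metis add_Suc_right append.assoc)
  qed simp
  have eq: "s m ! i = s n ! i" if "m \<le> n" "i < length (s m)" for i m n
    using ext[of m "n - m"] that by (auto simp: nth_append)
  define \<alpha> where "\<alpha> i = s (Suc i) ! i" for i
  have "\<alpha> \<in> cyl (s n)" for n
    unfolding cyl_conv
  proof clarify
    fix i assume i: "i < length (s n)"
    show "\<alpha> i = s n ! i"
    proof (cases "Suc i \<le> n")
      case True
      then show ?thesis using eq[of "Suc i" n i] len[of "Suc i"] by (simp add: \<alpha>_def)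
    next
      case False
      then show ?thesis using eq[of n "Suc i" i] i by (simp add: \<alpha>_def)
    qed
  qed
  then show ?thesis using len that by blast
qed

lemma cyl_pre_mono:
  assumes "\<alpha> \<in> cyl s" "n \<le> length s"
  shows "cyl s \<subseteq> cyl (pre n \<alpha>)"
  using assms by (auto simp: cyl_conv pre_def)

text \<open>If the sets were inseparable, \<open>borel_separated_UN\<close> would give ever smaller
  inseparable pairs of cylinders, shrinking to \<alpha> and \<beta>. Their images are different
  points, so by continuity small cylinders have images in disjoint clopen sets.\<close>

lemma lusin_separation:
  assumes "analytic A" "analytic B" "A \<inter> B = {}"
  shows "borel_separated A B"
proof (rule ccontr)
  assume nsep: "\<not> borel_separated A B"
  obtain K :: "baire set" and f where K: "closed K" "continuous_on K f" "A = f ` K"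
    using assms(1) by (auto simp: analytic_def)
  obtain L :: "baire set" and g where L: "closed L" "continuous_on L g" "B = g ` L"
    using assms(2) by (auto simp: analytic_def)
  let ?bad = "\<lambda>st. \<not> borel_separated (f ` (K \<inter> cyl (fst st))) (g ` (L \<inter> cyl (snd st)))"
  have "\<exists>st. \<forall>n. ?bad (st n) \<and> (\<exists>i j. st (Suc n) = (fst (st n) @ [i], snd (st n) @ [j]))"
  proof (rule dependent_nat_choice[where P="\<lambda>_. ?bad"])
    show "\<exists>st. ?bad st" using nsep by (intro exI[of _ "([], [])"]) (simp add: K(3) L(3))
  next
    fix st :: "nat list \<times> nat list" and n :: nat
    assume "?bad st"
    moreover have "f ` (K \<inter> cyl (fst st)) = (\<Union>i. f ` (K \<inter> cyl (fst st @ [i])))"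
      "g ` (L \<inter> cyl (snd st)) = (\<Union>i. g ` (L \<inter> cyl (snd st @ [i])))"
      by (subst cyl_UN_snoc, blast)+
    ultimately obtain i j where
      "\<not> borel_separated (f ` (K \<inter> cyl (fst st @ [i]))) (g ` (L \<inter> cyl (snd st @ [j])))"
      using borel_separated_UN[of "\<lambda>i. f ` (K \<inter> cyl (fst st @ [i]))" "\<lambda>j. g ` (L \<inter> cyl (snd st @ [j]))"]
      by auto
    then show "\<exists>st'. ?bad st' \<and> (\<exists>i j. st' = (fst st @ [i], snd st @ [j]))"
      by (intro exI[of _ "(fst st @ [i], snd st @ [j])"]) auto
  qed
  then obtain st where st: "\<And>n. ?bad (st n)"
    "\<And>n. \<exists>i j. st (Suc n) = (fst (st n) @ [i], snd (st n) @ [j])" by blast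
  have "\<exists>w. w \<noteq> [] \<and> fst (st (Suc n)) = fst (st n) @ w" for n
    using st(2)[of n] by auto
  then obtain \<alpha> where \<alpha>: "\<And>n. \<alpha> \<in> cyl (fst (st n))" "\<And>n. n \<le> length (fst (st n))"
    by (rule chain_limit[where s = "\<lambda>n. fst (st n)"]) blast
  have "\<exists>w. w \<noteq> [] \<and> snd (st (Suc n)) = snd (st n) @ w" for n
    using st(2)[of n] by auto
  then obtain \<beta> where \<beta>: "\<And>n. \<beta> \<in> cyl (snd (st n))" "\<And>n. n \<le> length (snd (st n))"
    by (rule chain_limit[where s = "\<lambda>n. snd (st n)"]) blast
  \<comment> \<open>The empty set is separated from everything, so the cylinders keep meeting the
    parameter sets, and the limits belong to these.\<close>
  have ne: "K \<inter> cyl (fst (st n)) \<noteq> {}" "L \<inter> cyl (snd (st n)) \<noteq> {}" for n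
    using st(1)[of n] by (force simp: borel_separated_def)+
  have "\<alpha> \<in> K"
    by (rule closed_limit_cyl[OF K(1)]) (use ne(1) cyl_pre_mono[OF \<alpha>(1,2)] in blast)
  moreover have "\<beta> \<in> L"
    by (rule closed_limit_cyl[OF L(1)]) (use ne(2) cyl_pre_mono[OF \<beta>(1,2)] in blast)
  ultimately have "f \<alpha> \<noteq> g \<beta>" using assms(3) K(3) L(3) by blast
  then obtain i where i: "f \<alpha> i \<noteq> g \<beta> i" by auto
  obtain m where m: "f ` (K \<inter> cyl (pre m \<alpha>)) \<subseteq> {\<gamma>. \<gamma> i \<in> {f \<alpha> i}}"
    using continuous_on_cyl_image[OF K(2) \<open>\<alpha> \<in> K\<close> open_coord[of i "{f \<alpha> i}"]] by auto
  obtain n where n: "g ` (L \<inter> cyl (pre n \<beta>)) \<subseteq> {\<gamma>. \<gamma> i \<in> {g \<beta> i}}"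
    using continuous_on_cyl_image[OF L(2) \<open>\<beta> \<in> L\<close> open_coord[of i "{g \<beta> i}"]] by auto
  let ?N = "max m n"
  have "m \<le> length (fst (st ?N))" "n \<le> length (snd (st ?N))"
    using \<alpha>(2)[of ?N] \<beta>(2)[of ?N] by auto
  note sub = cyl_pre_mono[OF \<alpha>(1) this(1)] cyl_pre_mono[OF \<beta>(1) this(2)]
  have "f ` (K \<inter> cyl (fst (st ?N))) \<subseteq> {\<gamma>. \<gamma> i \<in> {f \<alpha> i}}"
    by (rule order_trans[OF image_mono[OF Int_mono[OF order_refl sub(1)]] m])
  moreover have "g ` (L \<inter> cyl (snd (st ?N))) \<subseteq> {\<gamma>. \<gamma> i \<in> {g \<beta> i}}"
    by (rule order_trans[OF image_mono[OF Int_mono[OF order_refl sub(2)]] n])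
  moreover have "{\<gamma>. \<gamma> i \<in> {g \<beta> i}} \<inter> {\<gamma>. \<gamma> i \<in> {f \<alpha> i}} = {}" using i by auto
  ultimately have "borel_separated (f ` (K \<inter> cyl (fst (st ?N)))) (g ` (L \<inter> cyl (snd (st ?N))))"
    unfolding borel_separated_def
    by (intro bexI[OF _ borel_open[OF open_coord[of i "{f \<alpha> i}"]]]) blast
  then show False using st(1) by blast
qed

text \<open>The points whose value has i-th coordinate \<open>j\<close> and those whose value has
  another one form disjoint analytic sets. Once Borel sets \<open>C i j\<close> separate them, the
  i-th coordinate is the only \<open>j\<close> with \<open>x\<close> in \<open>C i j\<close>. Off
  the projection of \<open>A\<close> the \<open>LEAST\<close> operator still gives some value, so
  the function is total and Borel.\<close>

lemma analytic_single_valued_graph: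
  fixes A :: "(baire \<times> baire) set"
  assumes "analytic A" "single_valued A"
  obtains g where "g \<in> borel \<rightarrow>\<^sub>M (borel :: baire measure)" "\<And>x y. (x, y) \<in> A \<Longrightarrow> y = g x"
proof -
  define p where "p i N = fst ` (A \<inter> {q. snd q i \<in> N})" for i N
  have an: "analytic (p i N)" for i N
  proof -
    have "closed {q :: baire \<times> baire. snd q i \<in> N}"
      using closed_vimage[OF closed_coord[of i N], of snd] by (simp add: vimage_def continuous_on_snd)
    then show ?thesis
      unfolding p_def by (intro analytic_image analytic_Int_closed assms(1) continuous_on_fst continuous_on_id)
  qed
  have "p i {j} \<inter> p i (- {j}) = {}" for i j
    using assms(2) unfolding p_def single_valued_def by fastforce
  then have "\<exists>C \<in> sets borel. p i {j} \<subseteq> C \<and> p i (- {j}) \<inter> C = {}" for i j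
    using lusin_separation[OF an an, of i "{j}" i "- {j}"] by (simp only: borel_separated_def)
  then obtain C where C: "\<And>i j. C i j \<in> sets borel" "\<And>i j. p i {j} \<subseteq> C i j"
      "\<And>i j. p i (- {j}) \<inter> C i j = {}"
    by metis
  define g where "g x i = (LEAST j. x \<in> C i j)" for x i
  have "g \<in> borel \<rightarrow>\<^sub>M (borel :: baire measure)"
  proof (rule measurable_baireI)
    fix i
    have [measurable]: "Measurable.pred borel (\<lambda>x. x \<in> C i j)" for j
      using C(1) by (simp add: pred_def)
    show "(\<lambda>x. g x i) \<in> borel \<rightarrow>\<^sub>M count_space UNIV" unfolding g_def by measurable
  qed
  moreover have "y = g x" if xy: "(x, y) \<in> A" for x y
  proof
    fix i
    have "x \<in> C i (y i)" using xy C(2)[of i "y i"] unfolding p_def by force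
    moreover have "x \<notin> C i j" if "j \<noteq> y i" for j
      using xy C(3)[of i j] that unfolding p_def by force
    ultimately show "y i = g x i" unfolding g_def by (metis (mono_tags, lifting) LeastI)
  qed
  ultimately show ?thesis by (rule that)
qed

section \<open>Splitting configurations over a common first coordinate\<close>

definition cov :: "(baire \<Rightarrow> baire) set \<Rightarrow> (baire \<times> baire) set" where
  "cov F = {(x, y). \<exists>g\<in>F. y = g x}"

text \<open>The analytic set under consideration is parametrized as \<open>h ` K\<close>, and \<open>a\<close> is a tuple of codes of
  cylinders.\<close>

definition config :: "baire set \<Rightarrow> (baire \<Rightarrow> baire \<times> baire) \<Rightarrow> (baire \<Rightarrow> baire) set \<Rightarrow> nat list list
    \<Rightarrow> (nat \<Rightarrow> baire) \<Rightarrow> bool" where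
  "config K h F a z \<longleftrightarrow> (\<forall>j<length a. z j \<in> K \<and> z j \<in> cyl (a ! j) \<and>
     fst (h (z j)) = fst (h (z 0)) \<and> h (z j) \<notin> cov F)"

definition slice :: "baire set \<Rightarrow> (baire \<Rightarrow> baire \<times> baire) \<Rightarrow> (baire \<Rightarrow> baire) set \<Rightarrow> nat list list
    \<Rightarrow> nat \<Rightarrow> (baire \<times> baire) set" where
  "slice K h F a i = {h (z i) | z. config K h F a z}"

lemma cov_mono: "F \<subseteq> F' \<Longrightarrow> cov F \<subseteq> cov F'"
  by (auto simp: cov_def)

lemma config_antimono: "F \<subseteq> F' \<Longrightarrow> config K h F' a z \<Longrightarrow> config K h F a z"
  using cov_mono[of F F'] unfolding config_def by blast

lemma slice_antimono: "F \<subseteq> F' \<Longrightarrow> slice K h F' a i \<subseteq> slice K h F a i"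
  using config_antimono[of F F'] unfolding slice_def by blast

text \<open>Packed into single points, configurations form a Borel set because \<open>F\<close>
  consists of countably many Borel functions; the slice is a continuous image of this set.\<close>

lemma analytic_slice:
  assumes K: "closed K" "continuous_on K h"
    and F: "countable F" "F \<subseteq> (borel :: baire measure) \<rightarrow>\<^sub>M (borel :: baire measure)"
    and i: "i < length a"
  shows "analytic (slice K h F a i)"
proof -
  \<comment> \<open>\<open>h\<close> is controlled only on \<open>K\<close>; a default value off
    \<open>K\<close> makes its components Borel on the whole space.\<close>
  define H1 where "H1 \<alpha> = (if \<alpha> \<in> K then fst (h \<alpha>) else (\<lambda>_. 0))" for \<alpha>
  define H2 where "H2 \<alpha> = (if \<alpha> \<in> K then snd (h \<alpha>) else (\<lambda>_. 0))" for \<alpha>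
  have Kb: "K \<in> sets borel" using K(1) by (rule borel_closed)
  have [measurable]: "H1 \<in> borel \<rightarrow>\<^sub>M borel" unfolding H1_def
    by (rule borel_measurable_continuous_on_if[OF Kb continuous_on_fst[OF K(2)] continuous_on_const])
  have [measurable]: "H2 \<in> borel \<rightarrow>\<^sub>M borel" unfolding H2_def
    by (rule borel_measurable_continuous_on_if[OF Kb continuous_on_snd[OF K(2)] continuous_on_const])
  have [measurable]: "col j \<in> borel \<rightarrow>\<^sub>M borel" for j
    by (rule borel_measurable_continuous_onI[OF continuous_on_col])
  have [measurable]: "Measurable.pred borel (\<lambda>\<alpha>. \<alpha> \<in> K)" "Measurable.pred borel (\<lambda>\<alpha>. \<alpha> \<in> cyl s)" for s
    using Kb borel_closed[OF closed_cyl] by (simp_all add: pred_def)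
  define Q where "Q = {\<alpha>. \<forall>j\<in>{..<length a}. col j \<alpha> \<in> K \<and> col j \<alpha> \<in> cyl (a ! j) \<and>
      (\<forall>k. H1 (col j \<alpha>) k = H1 (col 0 \<alpha>) k) \<and> (\<forall>g\<in>F. \<exists>k. H2 (col j \<alpha>) k \<noteq> g (H1 (col j \<alpha>)) k)}"
  have "Measurable.pred borel (\<lambda>\<alpha>. \<forall>g\<in>F. \<exists>k. H2 (col j \<alpha>) k \<noteq> g (H1 (col j \<alpha>)) k)" for j
    unfolding pred_def
  proof (rule sets.sets_Collect_countable_All'[OF _ F(1)])
    fix g assume "g \<in> F"
    then have [measurable]: "g \<in> borel \<rightarrow>\<^sub>M borel" using F(2) by blast
    show "{\<alpha> \<in> space borel. \<exists>k. H2 (col j \<alpha>) k \<noteq> g (H1 (col j \<alpha>)) k} \<in> sets borel" by measurable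
  qed
  note [measurable] = this
  have "Measurable.pred borel (\<lambda>\<alpha>. \<alpha> \<in> Q)"
    unfolding Q_def mem_Collect_eq by measurable
  then have "analytic Q" by (intro borel_imp_analytic) (simp add: pred_def)
  have Q: "\<alpha> \<in> Q \<longleftrightarrow> config K h F a (\<lambda>j. col j \<alpha>)" for \<alpha>
  proof -
    have "h \<beta> \<notin> cov F \<longleftrightarrow> (\<forall>g\<in>F. \<exists>k. snd (h \<beta>) k \<noteq> g (fst (h \<beta>)) k)" for \<beta>
      unfolding cov_def by (cases "h \<beta>") (auto simp: fun_eq_iff)
    moreover have "0 < length a" using i by linarith
    ultimately show ?thesis
      unfolding Q_def config_def H1_def H2_def by (auto simp: fun_eq_iff)
  qed
  have "continuous_on Q (\<lambda>\<alpha>. h (col i \<alpha>))"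
    by (rule continuous_on_compose2[OF K(2) continuous_on_col]) (use i in \<open>auto simp: Q config_def\<close>)
  with \<open>analytic Q\<close> have "analytic ((\<lambda>\<alpha>. h (col i \<alpha>)) ` Q)" by (rule analytic_image)
  moreover have "(\<lambda>\<alpha>. h (col i \<alpha>)) ` Q = slice K h F a i"
  proof
    show "(\<lambda>\<alpha>. h (col i \<alpha>)) ` Q \<subseteq> slice K h F a i" by (auto simp: slice_def Q)
    show "slice K h F a i \<subseteq> (\<lambda>\<alpha>. h (col i \<alpha>)) ` Q"
    proof
      fix p assume "p \<in> slice K h F a i"
      then obtain z where z: "config K h F a z" "p = h (z i)" by (auto simp: slice_def)
      then have "merge z \<in> Q" "p = h (col i (merge z))" by (simp_all add: Q)
      then show "p \<in> (\<lambda>\<alpha>. h (col i \<alpha>)) ` Q" by blast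
    qed
  qed
  ultimately show ?thesis by simp
qed

text \<open>The cover \<open>F\<close> is chosen so large that a slice is single-valued outside some countable cover
  only if it is already covered by \<open>F\<close>. Hence, if \<open>F\<close> does not cover the set, every tuple carrying
  a configuration can be split at every index, and iterating the splitting produces a perfect set
  of parameters inside one vertical section.\<close>

lemma exists_saturated_cover:
  assumes K: "closed K" "continuous_on K h"
  obtains F where "countable F" "F \<subseteq> (borel :: baire measure) \<rightarrow>\<^sub>M (borel :: baire measure)"
    "\<And>a i z. i < length a \<Longrightarrow> config K h F a z \<Longrightarrow> \<not> single_valued (slice K h F a i)"
proof -
  define ok where "ok F \<longleftrightarrow> countable F \<and> F \<subseteq> (borel :: baire measure) \<rightarrow>\<^sub>M (borel :: baire measure)" for F
  \<comment> \<open>There are only countably many codes \<open>(a, i)\<close>, so one countable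
    cover \<open>F0\<close> can include a witness for each of them.\<close>
  define T where "T = {t. snd t < length (fst t) \<and> (\<exists>F. ok F \<and> single_valued (slice K h F (fst t) (snd t)))}"
  have "\<forall>t\<in>T. \<exists>F. ok F \<and> single_valued (slice K h F (fst t) (snd t))" by (auto simp: T_def)
  then obtain Ft where Ft: "\<forall>t\<in>T. ok (Ft t) \<and> single_valued (slice K h (Ft t) (fst t) (snd t))"
    by (rule bchoice[THEN exE])
  define F0 where "F0 = (\<Union>t\<in>T. Ft t)"
  have F0: "ok F0" using Ft unfolding ok_def F0_def by (auto intro!: countable_UN)
  \<comment> \<open>What \<open>F0\<close> leaves of such a slice is analytic and single-valued, so
    one further Borel function covers it.\<close>
  have "\<forall>t\<in>T. \<exists>g. g \<in> borel \<rightarrow>\<^sub>M (borel :: baire measure) \<and> slice K h F0 (fst t) (snd t) \<subseteq> cov {g}"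
  proof
    fix t assume t: "t \<in> T"
    then have "slice K h F0 (fst t) (snd t) \<subseteq> slice K h (Ft t) (fst t) (snd t)"
      by (intro slice_antimono) (auto simp: F0_def)
    then have "single_valued (slice K h F0 (fst t) (snd t))"
      using Ft t single_valued_subset by blast
    moreover have "analytic (slice K h F0 (fst t) (snd t))"
      by (rule analytic_slice[OF K]) (use F0 t in \<open>auto simp: ok_def T_def\<close>)
    ultimately obtain g where g: "g \<in> borel \<rightarrow>\<^sub>M (borel :: baire measure)"
        "\<And>x y. (x, y) \<in> slice K h F0 (fst t) (snd t) \<Longrightarrow> y = g x"
      using analytic_single_valued_graph[of "slice K h F0 (fst t) (snd t)"] by metis
    then show "\<exists>g. g \<in> borel \<rightarrow>\<^sub>M (borel :: baire measure) \<and> slice K h F0 (fst t) (snd t) \<subseteq> cov {g}"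
      by (intro exI[of _ g]) (auto simp: cov_def)
  qed
  then obtain gt where gt: "\<forall>t\<in>T. gt t \<in> borel \<rightarrow>\<^sub>M (borel :: baire measure) \<and>
      slice K h F0 (fst t) (snd t) \<subseteq> cov {gt t}"
    by (rule bchoice[THEN exE])
  define F where "F = F0 \<union> gt ` T"
  have F: "ok F" using F0 gt unfolding ok_def F_def by auto
  have "\<not> single_valued (slice K h F a i)" if i: "i < length a" and z: "config K h F a z" for a i z
  proof
    \<comment> \<open>Then the code belongs to \<open>T\<close>, so \<open>gt (a, i)\<close> covers
      \<open>h (z i)\<close>, although configurations avoid \<open>cov F\<close>.\<close>
    assume "single_valued (slice K h F a i)"
    then have t: "(a, i) \<in> T" using i F by (auto simp: T_def)
    have "config K h F0 a z" by (rule config_antimono[OF _ z]) (simp add: F_def)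
    then have "h (z i) \<in> slice K h F0 a i" by (auto simp: slice_def)
    then have "h (z i) \<in> cov {gt (a, i)}" using bspec[OF gt t] by auto
    also have "cov {gt (a, i)} \<subseteq> cov F" by (rule cov_mono) (use t in \<open>auto simp: F_def\<close>)
    finally show False using z i by (auto simp: config_def)
  qed
  with F show ?thesis by (intro that[of F]) (auto simp: ok_def)
qed

lemma mem_cyl_extend:
  assumes "\<alpha> \<in> cyl s" "length s < n"
  shows "\<exists>w. w \<noteq> [] \<and> pre n \<alpha> = s @ w"
proof -
  have "pre n \<alpha> = pre (length s) \<alpha> @ map \<alpha> [length s..<n]"
    using assms(2) upt_add_eq_append[of 0 "length s" "n - length s"] by (simp add: pre_def)
  moreover have "pre (length s) \<alpha> = s" using assms(1) by (simp add: cyl_def)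
  ultimately show ?thesis using assms(2) by (intro exI[of _ "map \<alpha> [length s..<n]"]) simp
qed

text \<open>As the slice is not single-valued, two configurations have i-th points over the same
  \<open>x\<close> with different second coordinates. All points of the first and the i-th point of
  the second lie over this \<open>x\<close>, so together they form a configuration with one more
  entry.\<close>

lemma split_config:
  assumes K: "continuous_on K h"
    and i: "i < length a" and sv: "\<not> single_valued (slice K h F a i)"
  obtains a' z where "config K h F a' z" "length a' = Suc (length a)"
    "\<And>j. j < length a \<Longrightarrow> \<exists>w. w \<noteq> [] \<and> a' ! j = a ! j @ w"
    "\<exists>w. w \<noteq> [] \<and> a' ! length a = a ! i @ w"
    "\<And>u v. u \<in> K \<Longrightarrow> u \<in> cyl (a' ! i) \<Longrightarrow> v \<in> K \<Longrightarrow> v \<in> cyl (a' ! length a) \<Longrightarrow> snd (h u) \<noteq> snd (h v)"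
proof -
  obtain x y y' where xy: "(x, y) \<in> slice K h F a i" "(x, y') \<in> slice K h F a i" "y \<noteq> y'"
    using sv by (auto simp: single_valued_def)
  obtain z where z: "config K h F a z" "h (z i) = (x, y)"
    using xy(1) by (force simp: slice_def)
  obtain z' where z': "config K h F a z'" "h (z' i) = (x, y')"
    using xy(2) by (force simp: slice_def)
  obtain k where k: "y k \<noteq> y' k" using xy(3) by auto
  have cont: "continuous_on K (\<lambda>\<alpha>. snd (h \<alpha>))" using K by (rule continuous_on_snd)
  have zK: "z i \<in> K" "z' i \<in> K" using z z' i by (auto simp: config_def)
  obtain n1 where n1: "(\<lambda>\<alpha>. snd (h \<alpha>)) ` (K \<inter> cyl (pre n1 (z i))) \<subseteq> {\<gamma>. \<gamma> k \<in> {y k}}"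
    by (rule continuous_on_cyl_image[OF cont zK(1) open_coord[of k "{y k}"]]) (auto simp: z(2))
  obtain n2 where n2: "(\<lambda>\<alpha>. snd (h \<alpha>)) ` (K \<inter> cyl (pre n2 (z' i))) \<subseteq> {\<gamma>. \<gamma> k \<in> {y' k}}"
    by (rule continuous_on_cyl_image[OF cont zK(2) open_coord[of k "{y' k}"]]) (auto simp: z'(2))
  \<comment> \<open>Beyond \<open>n1\<close> and \<open>n2\<close>, coordinate \<open>k\<close>
    tells the two halves apart; exceeding every \<open>length (a ! j)\<close> makes all words grow
    properly.\<close>
  define n where "n = Suc (n1 + n2 + sum_list (map length a))"
  have len: "length (a ! j) < n" if "j < length a" for j
    using that member_le_sum_list[of "length (a ! j)" "map length a"] by (auto simp: n_def)
  define a' where "a' = map (\<lambda>j. pre n (z j)) [0..<length a] @ [pre n (z' i)]"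
  define z'' where "z'' = z(length a := z' i)"
  have a': "length a' = Suc (length a)" "a' ! length a = pre n (z' i)"
    "\<And>j. j < length a \<Longrightarrow> a' ! j = pre n (z j)"
    by (auto simp: a'_def nth_append)
  have zc: "\<And>j. j < length a \<Longrightarrow> z j \<in> K \<and> z j \<in> cyl (a ! j) \<and> fst (h (z j)) = fst (h (z 0)) \<and> h (z j) \<notin> cov F"
    using z(1) by (simp add: config_def)
  have zc': "z' i \<in> K" "z' i \<in> cyl (a ! i)" "h (z' i) \<notin> cov F"
    using z'(1) i by (simp_all add: config_def)
  have "fst (h (z' i)) = fst (h (z 0))" using zc[OF i] z(2) z'(2) by simp
  moreover have "z'' 0 = z 0" using i by (auto simp: z''_def)
  ultimately have "config K h F a' z''"
    unfolding config_def a'(1) using zc zc' i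
    by (auto simp: less_Suc_eq z''_def a' mem_cyl_pre)
  moreover have "\<exists>w. w \<noteq> [] \<and> a' ! j = a ! j @ w" if "j < length a" for j
    unfolding a'(3)[OF that] by (rule mem_cyl_extend[OF _ len[OF that]]) (use zc that in blast)
  moreover have "\<exists>w. w \<noteq> [] \<and> a' ! length a = a ! i @ w"
    unfolding a'(2) by (rule mem_cyl_extend[OF zc'(2) len[OF i]])
  moreover have "snd (h u) \<noteq> snd (h v)"
    if u: "u \<in> K" "u \<in> cyl (a' ! i)" and v: "v \<in> K" "v \<in> cyl (a' ! length a)" for u v
  proof -
    have "u \<in> K \<inter> cyl (pre n1 (z i))" using u by (auto simp: a'(3)[OF i] mem_cyl_pre n_def)
    then have "snd (h u) k = y k" using n1 by auto
    moreover have "v \<in> K \<inter> cyl (pre n2 (z' i))" using v by (auto simp: a'(2) mem_cyl_pre n_def)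
    then have "snd (h v) k = y' k" using n2 by auto
    ultimately show ?thesis using k by auto
  qed
  ultimately show ?thesis using that a'(1) by blast
qed

lemma tendsto_coord:
  assumes "s \<longlonglongrightarrow> (\<alpha> :: baire)"
  shows "(\<lambda>n. s n i) \<longlonglongrightarrow> \<alpha> i"
  by (rule continuous_on_tendsto_compose[OF continuous_on_coord[of UNIV i] assms]) auto

text \<open>Stage \<open>n\<close> splits the index \<open>fst (prod_decode n)\<close>, so every
  index is split infinitely often. All branches lie over one point. Steering a branch around an
  enumeration of the countable section over it, as in Cantor's diagonal argument, yields a point of
  the section missing from the enumeration.\<close>

lemma saturated_cover_covers:
  assumes K: "closed K" "continuous_on K h"
    and sat: "\<And>a i z. i < length a \<Longrightarrow> config K h F a z \<Longrightarrow> \<not> single_valued (slice K h F a i)"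
    and ctbl: "\<And>x. countable {y. (x, y) \<in> h ` K}"
  shows "h ` K \<subseteq> cov F"
proof (rule ccontr)
  assume "\<not> h ` K \<subseteq> cov F"
  then obtain \<alpha>0 where \<alpha>0: "\<alpha>0 \<in> K" "h \<alpha>0 \<notin> cov F" by blast
  define Q where "Q n a a' \<longleftrightarrow> (\<forall>j<length a. \<exists>w. w \<noteq> [] \<and> a' ! j = a ! j @ w) \<and>
     (\<exists>w. w \<noteq> [] \<and> a' ! length a = a ! fst (prod_decode n) @ w) \<and>
     (\<forall>u v. u \<in> K \<and> u \<in> cyl (a' ! fst (prod_decode n)) \<and> v \<in> K \<and> v \<in> cyl (a' ! length a) \<longrightarrow> snd (h u) \<noteq> snd (h v))"
    for n and a a' :: "nat list list"
  have fst_le: "fst (prod_decode n) \<le> n" for n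
    using le_prod_encode_1[of "fst (prod_decode n)" "snd (prod_decode n)"] by simp
  have "\<exists>A. \<forall>n. (length (A n) = Suc n \<and> (\<exists>z. config K h F (A n) z)) \<and> Q n (A n) (A (Suc n))"
  proof (rule dependent_nat_choice)
    show "\<exists>a. length a = Suc 0 \<and> (\<exists>z. config K h F a z)"
      using \<alpha>0 by (intro exI[of _ "[[]]"]) (auto simp: config_def intro!: exI[of _ "\<lambda>_. \<alpha>0"])
  next
    fix a n assume a: "length a = Suc n \<and> (\<exists>z. config K h F a z)"
    then have i: "fst (prod_decode n) < length a" using fst_le[of n] by simp
    obtain z where "config K h F a z" using a by blast
    from split_config[OF K(2) i sat[OF i this]] obtain a' z' where
      "config K h F a' z'" "length a' = Suc (length a)"
      "\<And>j. j < length a \<Longrightarrow> \<exists>w. w \<noteq> [] \<and> a' ! j = a ! j @ w"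
      "\<exists>w. w \<noteq> [] \<and> a' ! length a = a ! fst (prod_decode n) @ w"
      "\<And>u v. u \<in> K \<Longrightarrow> u \<in> cyl (a' ! fst (prod_decode n)) \<Longrightarrow> v \<in> K \<Longrightarrow> v \<in> cyl (a' ! length a)
        \<Longrightarrow> snd (h u) \<noteq> snd (h v)"
      by metis
    then show "\<exists>a'. (length a' = Suc (Suc n) \<and> (\<exists>z. config K h F a' z)) \<and> Q n a a'"
      using a unfolding Q_def by (intro exI[of _ a']) auto
  qed
  then obtain A where A: "\<And>n. length (A n) = Suc n" "\<And>n. \<exists>z. config K h F (A n) z"
    "\<And>n. Q n (A n) (A (Suc n))" by blast
  from A(2) obtain z where z: "\<And>n. config K h F (A n) (z n)" by metis
  have step: "\<exists>w. w \<noteq> [] \<and> A (Suc n) ! j = A n ! j @ w" if "j \<le> n" for n j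
    using A(3)[of n] that by (auto simp: Q_def A(1) less_Suc_eq_le)
  have extd: "\<exists>w. A (n + k) ! j = A n ! j @ w" if "j \<le> n" for n k j
  proof (induction k)
    case (Suc k)
    then show ?case using step[of j "n + k"] that by (metis add_Suc_right append.assoc trans_le_add1)
  qed simp
  have zin: "z n j \<in> K" "z n j \<in> cyl (A n ! j)" "fst (h (z n j)) = fst (h (z n 0))" if "j \<le> n" for n j
    using z[of n, unfolded config_def A(1), rule_format, of j] that by auto
  obtain u where u: "\<And>n. u \<in> cyl (A n ! 0)" "\<And>n. n \<le> length (A n ! 0)"
    by (rule chain_limit[of "\<lambda>n. A n ! 0"]) (use step[of 0] in auto)
  \<comment> \<open>Every branch lies over the same point as the branch \<open>u\<close> of index 0:
    the entries of one configuration share their first coordinate, and they converge to the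
    branches.\<close>
  have lim: "w \<in> K" "fst (h w) = fst (h u)"
    if w: "\<And>m. w \<in> cyl (A (n m) ! j m)" "\<And>m. m \<le> length (A (n m) ! j m)"
      and nj: "\<And>m. j m \<le> n m" "\<And>m. m \<le> n m" for w n j
  proof -
    have v: "z (n m) (j m) \<in> cyl (pre m w)" for m
      using zin(2)[OF nj(1)[of m]] cyl_pre_mono[OF w(1) w(2)[of m]] by blast
    show wK: "w \<in> K" by (rule closed_limit_cyl[OF K(1)]) (use v zin(1)[OF nj(1)] in blast)
    have u': "z (n m) 0 \<in> cyl (pre m u)" for m
      using zin(2)[of 0 "n m"] cyl_pre_mono[OF u(1) order_trans[OF nj(2)[of m] u(2)[of "n m"]]] by blast
    have uK: "u \<in> K" by (rule closed_limit_cyl[OF K(1)]) (use u' zin(1)[of 0] in blast)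
    have "(\<lambda>m. h (z (n m) (j m))) \<longlonglongrightarrow> h w"
      by (rule continuous_on_tendsto_compose[OF K(2) cyl_limit[OF v] wK]) (simp add: zin(1)[OF nj(1)])
    moreover have "(\<lambda>m. h (z (n m) 0)) \<longlonglongrightarrow> h u"
      by (rule continuous_on_tendsto_compose[OF K(2) cyl_limit[OF u'] uK]) (simp add: zin(1))
    moreover have "fst (h (z (n m) (j m))) = fst (h (z (n m) 0))" for m by (rule zin(3)[OF nj(1)])
    ultimately have "(\<lambda>m. fst (h (z (n m) 0))) \<longlonglongrightarrow> fst (h w)" "(\<lambda>m. fst (h (z (n m) 0))) \<longlonglongrightarrow> fst (h u)"
      using tendsto_fst by fastforce+
    then show "fst (h w) = fst (h u)"
      by (intro ext) (rule LIMSEQ_unique[OF tendsto_coord tendsto_coord])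
  qed
  have uK: "u \<in> K" by (rule lim(1)[where n = "\<lambda>m. m" and j = "\<lambda>_. 0"]) (use u in auto)
  let ?Y = "{y. (fst (h u), y) \<in> h ` K}"
  have "snd (h u) \<in> ?Y" using uK by auto
  then have ne: "?Y \<noteq> {}" by (metis empty_iff)
  define y where "y = from_nat_into ?Y"
  have y: "range y = ?Y" unfolding y_def by (rule range_from_nat_into[OF ne ctbl])
  define R where "R m p p' \<longleftrightarrow> fst p < fst p' \<and> (\<exists>w. w \<noteq> [] \<and> A (fst p') ! snd p' = A (fst p) ! snd p @ w) \<and>
      (\<forall>v. v \<in> K \<and> v \<in> cyl (A (fst p') ! snd p') \<longrightarrow> snd (h v) \<noteq> y m)" for m p p'
  have "\<exists>p. \<forall>m. snd (p m) \<le> fst (p m) \<and> R m (p m) (p (Suc m))"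
  proof (rule dependent_nat_choice)
    show "\<exists>p :: nat \<times> nat. snd p \<le> fst p" by (rule exI[of _ "(0, 0)"]) simp
  next
    fix p :: "nat \<times> nat" and m
    assume p: "snd p \<le> fst p"
    \<comment> \<open>A stage no earlier than \<open>fst p\<close> at which the index
      \<open>snd p\<close> is split.\<close>
    define N where "N = prod_encode (snd p, fst p)"
    have N: "fst p \<le> N" "fst (prod_decode N) = snd p"
      using le_prod_encode_2[of "fst p" "snd p"] by (simp_all add: N_def)
    obtain w0 where w0: "A N ! snd p = A (fst p) ! snd p @ w0"
      using extd[OF p, of "N - fst p"] N(1) by auto
    obtain w1 where w1: "w1 \<noteq> []" "A (Suc N) ! snd p = A N ! snd p @ w1"
      using step[of "snd p" N] p N(1) by auto
    have QN: "Q N (A N) (A (Suc N))" by (rule A(3))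
    obtain w2 where w2: "w2 \<noteq> []" "A (Suc N) ! Suc N = A N ! snd p @ w2"
      using QN unfolding Q_def A(1) N(2) by blast
    have sep: "snd (h u) \<noteq> snd (h v)" if "u \<in> K" "u \<in> cyl (A (Suc N) ! snd p)" "v \<in> K" "v \<in> cyl (A (Suc N) ! Suc N)" for u v
      using QN that unfolding Q_def A(1) N(2) by blast
    \<comment> \<open>The two halves share no second coordinate, so if one of them reaches
      \<open>y m\<close>, the other avoids it.\<close>
    show "\<exists>p'. snd p' \<le> fst p' \<and> R m p p'"
    proof (cases "\<exists>v. v \<in> K \<and> v \<in> cyl (A (Suc N) ! snd p) \<and> snd (h v) = y m")
      case True
      then have "\<forall>v. v \<in> K \<and> v \<in> cyl (A (Suc N) ! Suc N) \<longrightarrow> snd (h v) \<noteq> y m" using sep by metis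
      then show ?thesis
        using w0 w2 N(1) by (intro exI[of _ "(Suc N, Suc N)"]) (auto simp: R_def)
    next
      case False
      then show ?thesis
        using w0 w1 N(1) p by (intro exI[of _ "(Suc N, snd p)"]) (auto simp: R_def)
    qed
  qed
  then obtain p where p: "\<And>m. snd (p m) \<le> fst (p m)" "\<And>m. R m (p m) (p (Suc m))" by blast
  have "\<exists>w. w \<noteq> [] \<and> A (fst (p (Suc m))) ! snd (p (Suc m)) = A (fst (p m)) ! snd (p m) @ w" for m
    using p(2)[of m] by (simp add: R_def)
  then obtain w where w: "\<And>m. w \<in> cyl (A (fst (p m)) ! snd (p m))" "\<And>m. m \<le> length (A (fst (p m)) ! snd (p m))"
    by (rule chain_limit[of "\<lambda>m. A (fst (p m)) ! snd (p m)"]) blast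
  have "m \<le> fst (p m)" for m
  proof (induction m)
    case (Suc m)
    then show ?case using p(2)[of m] by (simp add: R_def)
  qed simp
  from lim[where n = "\<lambda>m. fst (p m)" and j = "\<lambda>m. snd (p m)", OF w p(1) this]
  have wK: "w \<in> K" "fst (h w) = fst (h u)" .
  have "(fst (h u), snd (h w)) = h w" by (simp add: wK(2)[symmetric])
  then have "(fst (h u), snd (h w)) \<in> h ` K" using wK(1) by (simp only: imageI)
  then have "snd (h w) \<in> ?Y" by (simp only: mem_Collect_eq)
  then obtain m where m: "snd (h w) = y m" using y by auto
  show False using p(2)[of m] w(1)[of "Suc m"] wK(1) m by (auto simp: R_def)
qed

theorem lusin_novikov_baire:
  assumes "analytic P" "\<And>x. countable {y. (x, y) \<in> P}"
  obtains g :: "nat \<Rightarrow> baire \<Rightarrow> baire" where "\<And>n. g n \<in> borel \<rightarrow>\<^sub>M borel"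
    "\<And>x y. (x, y) \<in> P \<Longrightarrow> \<exists>n. y = g n x"
proof -
  obtain K :: "baire set" and h where K: "closed K" "continuous_on K h" "P = h ` K"
    using assms(1) by (auto simp: analytic_def)
  obtain F where F: "countable F" "F \<subseteq> (borel :: baire measure) \<rightarrow>\<^sub>M (borel :: baire measure)"
    "\<And>a i z. i < length a \<Longrightarrow> config K h F a z \<Longrightarrow> \<not> single_valued (slice K h F a i)"
    by (rule exists_saturated_cover[OF K(1,2)]) blast
  have cov: "P \<subseteq> cov F"
    unfolding K(3) by (rule saturated_cover_covers[OF K(1,2) F(3)]) (use assms(2) K(3) in auto)
  \<comment> \<open>\<open>id\<close> makes the family nonempty, so that it can be
    enumerated.\<close>
  let ?F = "insert id F"
  have g: "range (from_nat_into ?F) = ?F" using F(1) by (intro range_from_nat_into) auto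
  have "from_nat_into ?F n \<in> borel \<rightarrow>\<^sub>M (borel :: baire measure)" for n
  proof -
    have "from_nat_into ?F n \<in> ?F" by (rule from_nat_into) simp
    then show ?thesis using F(2) by (auto simp: id_def)
  qed
  moreover have "\<exists>n. y = from_nat_into ?F n x" if "(x, y) \<in> P" for x y
  proof -
    have "(x, y) \<in> cov F" using that cov by blast
    then obtain g' where "g' \<in> ?F" "y = g' x" by (auto simp: cov_def)
    then show ?thesis using g by (metis imageE)
  qed
  ultimately show ?thesis by (rule that)
qed

section \<open>Standard Borel spaces\<close>

text \<open>For each \<open>k\<close>, \<open>\<phi> x\<close> names the first point of a dense
  sequence within distance \<open>e k\<close> of \<open>x\<close>, and \<psi> takes the limit of the
  named points. By completeness \<open>C\<close> is exactly the set of sequences that name some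
  point, and it is given by countably many conditions on coordinates.\<close>

lemma standard_borel_coding:
  assumes "standard_borel_space M" "space M \<noteq> {}"
  obtains \<phi> \<psi> where "\<phi> \<in> M \<rightarrow>\<^sub>M (borel :: baire measure)" "\<psi> \<in> (borel :: baire measure) \<rightarrow>\<^sub>M M"
    "\<And>x. x \<in> space M \<Longrightarrow> \<psi> (\<phi> x) = x"
proof -
  obtain \<tau> where \<tau>: "completely_metrizable_space \<tau>" "separable_space \<tau>" "topspace \<tau> = space M"
    "sets M = sigma_sets (space M) {U. openin \<tau> U}"
    using assms(1) unfolding standard_borel_space_def by blast
  obtain X d where Xd: "Metric_space X d" "Metric_space.mcomplete X d" "\<tau> = Metric_space.mtopology X d"
    using \<tau>(1) unfolding completely_metrizable_space_def by blast
  interpret Metric_space X d by (rule Xd(1))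
  have X: "X = space M" using \<tau>(3) Xd(3) by simp
  obtain D where D: "countable D" "D \<subseteq> X" "mtopology closure_of D = X"
    using \<tau>(2) unfolding separable_space_def Xd(3) by auto
  have "D \<noteq> {}" using D(3) assms(2) X by force
  define q where "q = from_nat_into D"
  have qX: "q n \<in> X" for n using from_nat_into[OF \<open>D \<noteq> {}\<close>] D(2) unfolding q_def by blast
  have dense: "\<exists>n. d (q n) x < r" if x: "x \<in> X" "r > 0" for x r
  proof -
    have "x \<in> mtopology closure_of D" using x D(3) by simp
    then obtain y where y: "y \<in> D" "y \<in> mball x r" using x(2) unfolding metric_closure_of by auto
    obtain n where "q n = y" using from_nat_into_surj[OF D(1) y(1)] unfolding q_def by blast
    then show ?thesis using y(2) commute[of x y] by auto
  qed
  define e :: "nat \<Rightarrow> real" where "e k = (1/2) ^ k" for k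
  have e0: "e k > 0" for k by (simp add: e_def)
  have esmall: "\<exists>k. e k < r" if "r > 0" for r
    using real_arch_pow_inv[of r "1/2"] that by (auto simp: e_def)
  have emono: "e l \<le> e k" if "k \<le> l" for k l
    using that by (auto simp: e_def intro: power_decreasing)
  define \<phi> where "\<phi> x k = (LEAST n. d (q n) x < e k)" for x k
  define C where "C = {\<alpha> :: baire. \<forall>k l. d (q (\<alpha> k)) (q (\<alpha> l)) \<le> e k + e l}"
  define L where "L \<alpha> x \<longleftrightarrow> x \<in> X \<and> (\<forall>k. d (q (\<alpha> k)) x \<le> e k)" for \<alpha> :: baire and x
  define \<psi> where "\<psi> \<alpha> = (if \<alpha> \<in> C then SOME x. L \<alpha> x else q 0)" for \<alpha>
  have opn: "U \<in> sets M" if "openin \<tau> U" for U unfolding \<tau>(4) using that by blast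
  have m1: "Measurable.pred M (\<lambda>x. d (q n) x < r)" for n r
  proof -
    have "{x \<in> space M. d (q n) x < r} = mball (q n) r"
      unfolding X[symmetric] mball_def using qX by auto
    then show ?thesis using opn[of "mball (q n) r"] unfolding pred_def Xd(3) by simp
  qed
  have C: "{\<alpha> \<in> space borel. \<alpha> \<in> C} \<in> sets borel"
    unfolding C_def mem_Collect_eq by measurable
  have L_C: "\<alpha> \<in> C" if "L \<alpha> x" for \<alpha> x
  proof -
    have "d (q (\<alpha> k)) (q (\<alpha> l)) \<le> e k + e l" for k l
      using that triangle[of "q (\<alpha> k)" x "q (\<alpha> l)"] qX commute[of x "q (\<alpha> l)"]
      unfolding L_def by (smt (verit))
    then show ?thesis by (simp add: C_def)
  qed
  have L_ex: "\<exists>x. L \<alpha> x" if "\<alpha> \<in> C" for \<alpha>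
  proof -
    have dC: "d (q (\<alpha> k)) (q (\<alpha> l)) \<le> e k + e l" for k l using that by (simp add: C_def)
    have "MCauchy (\<lambda>k. q (\<alpha> k))"
      unfolding MCauchy_def
    proof (intro conjI allI impI)
      show "range (\<lambda>k. q (\<alpha> k)) \<subseteq> X" using qX by auto
      fix \<epsilon> :: real assume "\<epsilon> > 0"
      then obtain N where N: "e N < \<epsilon> / 2" using esmall[of "\<epsilon>/2"] by auto
      have "d (q (\<alpha> k)) (q (\<alpha> l)) < \<epsilon>" if "N \<le> k" "N \<le> l" for k l
        using dC[of k l] emono[OF that(1)] emono[OF that(2)] N by linarith
      then show "\<exists>N. \<forall>k l. N \<le> k \<longrightarrow> N \<le> l \<longrightarrow> d (q (\<alpha> k)) (q (\<alpha> l)) < \<epsilon>" by blast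
    qed
    then obtain x where x: "limitin mtopology (\<lambda>k. q (\<alpha> k)) x sequentially"
      using Xd(2) unfolding mcomplete_def by blast
    then have xX: "x \<in> X" and conv: "\<And>\<epsilon>. \<epsilon> > 0 \<Longrightarrow> \<exists>N. \<forall>n\<ge>N. q (\<alpha> n) \<in> X \<and> d (q (\<alpha> n)) x < \<epsilon>"
      unfolding limit_metric_sequentially by auto
    have "d (q (\<alpha> k)) x \<le> e k" for k
    proof (rule field_le_epsilon)
      fix \<epsilon> :: real assume "\<epsilon> > 0"
      then obtain N where N: "\<forall>n\<ge>N. q (\<alpha> n) \<in> X \<and> d (q (\<alpha> n)) x < \<epsilon> / 2" using conv[of "\<epsilon>/2"] by auto
      obtain N' where N': "e N' < \<epsilon> / 2" using esmall[of "\<epsilon>/2"] \<open>\<epsilon> > 0\<close> by auto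
      define n where "n = max N N'"
      have "d (q (\<alpha> n)) x < \<epsilon> / 2" "e n < \<epsilon> / 2" using N N' emono[of N' n] by (auto simp: n_def)
      moreover have "d (q (\<alpha> k)) x \<le> d (q (\<alpha> k)) (q (\<alpha> n)) + d (q (\<alpha> n)) x"
        by (rule triangle) (use qX xX in auto)
      ultimately show "d (q (\<alpha> k)) x \<le> e k + \<epsilon>" using dC[of k n] by linarith
    qed
    then show ?thesis using xX unfolding L_def by blast
  qed
  have L_unique: "x = y" if "L \<alpha> x" "L \<alpha> y" for \<alpha> x y
  proof (rule ccontr)
    assume "x \<noteq> y"
    have XX: "x \<in> X" "y \<in> X" using that by (auto simp: L_def)
    then have "d x y > 0" using \<open>x \<noteq> y\<close> by (simp add: mdist_pos_less)
    then obtain k where k: "e k < d x y / 2" using esmall[of "d x y / 2"] by auto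
    have "d x y \<le> d x (q (\<alpha> k)) + d (q (\<alpha> k)) y" by (rule triangle) (use qX XX in auto)
    also have "\<dots> \<le> e k + e k" using that commute[of x "q (\<alpha> k)"] unfolding L_def by (metis add_mono)
    finally show False using k by linarith
  qed
  have \<psi>L: "L \<alpha> (\<psi> \<alpha>)" if "\<alpha> \<in> C" for \<alpha>
    using someI_ex[OF L_ex[OF that]] that by (simp add: \<psi>_def)
  have "L (\<phi> x) x" if "x \<in> X" for x
  proof -
    have "d (q (\<phi> x k)) x < e k" for k
      unfolding \<phi>_def by (rule LeastI_ex) (rule dense[OF that e0])
    then show ?thesis using that unfolding L_def by (simp add: less_imp_le)
  qed
  then have inv: "\<psi> (\<phi> x) = x" if "x \<in> X" for x
    using that L_unique \<psi>L L_C by blast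
  have "\<phi> \<in> M \<rightarrow>\<^sub>M (borel :: baire measure)"
  proof (rule measurable_baireI)
    fix k
    note m1[measurable]
    show "(\<lambda>x. \<phi> x k) \<in> M \<rightarrow>\<^sub>M count_space UNIV" unfolding \<phi>_def by measurable
  qed
  moreover have "\<psi> \<in> (borel :: baire measure) \<rightarrow>\<^sub>M M"
  proof (rule measurable_sigma_sets[OF \<tau>(4)])
    show "{U. openin \<tau> U} \<subseteq> Pow (space M)" using openin_subset \<tau>(3) by blast
    show "\<psi> \<in> space borel \<rightarrow> space M" 
    proof
      fix \<alpha>
      show "\<psi> \<alpha> \<in> space M" using \<psi>L[of \<alpha>] qX X by (cases "\<alpha> \<in> C") (auto simp: L_def \<psi>_def)
    qed
    fix U assume "U \<in> {U. openin \<tau> U}"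
    then have U: "openin mtopology U" using Xd(3) by simp
    \<comment> \<open>As \<open>\<psi> \<alpha>\<close> is within \<open>e k\<close> of the named
      point, it lies in the open ball of radius \<open>2 * e k\<close>, and this ball stays within
      \<open>3 * e k\<close> of it; hence the \<open>r / 3\<close> below.\<close>
    define B where "B k n \<longleftrightarrow> mball (q n) (2 * e k) \<subseteq> U" for k n
    have iff: "\<psi> \<alpha> \<in> U \<longleftrightarrow> (\<exists>k. B k (\<alpha> k))" if "\<alpha> \<in> C" for \<alpha>
    proof
      have L: "\<psi> \<alpha> \<in> X" "\<And>k. d (q (\<alpha> k)) (\<psi> \<alpha>) \<le> e k" using \<psi>L[OF that] by (auto simp: L_def)
      show "\<psi> \<alpha> \<in> U" if B: "\<exists>k. B k (\<alpha> k)"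
      proof -
        obtain k where k: "B k (\<alpha> k)" using B by blast
        have "\<psi> \<alpha> \<in> mball (q (\<alpha> k)) (2 * e k)" using L(1) L(2)[of k] e0[of k] qX by simp
        then show ?thesis using k unfolding B_def by blast
      qed
      show "\<exists>k. B k (\<alpha> k)" if \<psi>U: "\<psi> \<alpha> \<in> U"
      proof -
        obtain r where r: "r > 0" "mball (\<psi> \<alpha>) r \<subseteq> U" using U \<psi>U unfolding openin_mtopology by blast
        obtain k where k: "e k < r / 3" using esmall[of "r/3"] r(1) by auto
        have "mball (q (\<alpha> k)) (2 * e k) \<subseteq> mball (\<psi> \<alpha>) r"
        proof
          fix y assume y: "y \<in> mball (q (\<alpha> k)) (2 * e k)"
          have "d (\<psi> \<alpha>) y \<le> d (\<psi> \<alpha>) (q (\<alpha> k)) + d (q (\<alpha> k)) y"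
            by (rule triangle) (use L(1) qX y in auto)
          also have "\<dots> < r" using L(2)[of k] y k commute[of "\<psi> \<alpha>" "q (\<alpha> k)"] by simp
          finally show "y \<in> mball (\<psi> \<alpha>) r" using y L(1) by simp
        qed
        then show ?thesis using r(2) unfolding B_def by blast
      qed
    qed
    have "{\<alpha> \<in> space borel. \<exists>k. B k (\<alpha> k)} \<in> sets borel" by measurable
    then have "{\<alpha> \<in> space borel. \<alpha> \<in> C} \<inter> {\<alpha> \<in> space borel. \<exists>k. B k (\<alpha> k)} \<in> sets borel"
      using C by blast
    moreover have "(if q 0 \<in> U then space borel - {\<alpha> \<in> space borel. \<alpha> \<in> C} else {}) \<in> sets borel"
      using C by auto
    moreover have "\<psi> -` U \<inter> space borel = ({\<alpha> \<in> space borel. \<alpha> \<in> C} \<inter> {\<alpha> \<in> space borel. \<exists>k. B k (\<alpha> k)})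
        \<union> (if q 0 \<in> U then space borel - {\<alpha> \<in> space borel. \<alpha> \<in> C} else {})"
    proof -
      have "\<psi> \<alpha> \<in> U \<longleftrightarrow> (\<alpha> \<in> C \<and> (\<exists>k. B k (\<alpha> k))) \<or> (\<alpha> \<notin> C \<and> q 0 \<in> U)" for \<alpha>
      proof (cases "\<alpha> \<in> C")
        case True
        then show ?thesis using iff by simp
      qed (simp add: \<psi>_def)
      then show ?thesis by auto
    qed
    ultimately show "\<psi> -` U \<inter> space borel \<in> sets borel" by (simp only: sets.Un)
  qed
  ultimately show ?thesis using inv X that by blast
qed

theorem lusin_novikov:
  assumes M: "standard_borel_space M" and E: "E \<in> sets (M \<Otimes>\<^sub>M M)"
    and ctbl: "\<And>x. x \<in> space M \<Longrightarrow> countable {y. (x, y) \<in> E}"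
  obtains f :: "nat \<Rightarrow> 'a \<Rightarrow> 'a" where "\<And>n. f n \<in> M \<rightarrow>\<^sub>M M" "\<And>x y. (x, y) \<in> E \<Longrightarrow> \<exists>n. y = f n x"
proof (cases "space M = {}")
  case True
  then have "E = {}" using sets.sets_into_space[OF E] by (auto simp: space_pair_measure)
  then show ?thesis using that[of "\<lambda>_ x. x"] by simp
next
  case False
  obtain \<phi> \<psi> where \<phi>[measurable]: "\<phi> \<in> M \<rightarrow>\<^sub>M (borel :: baire measure)"
    and \<psi>[measurable]: "\<psi> \<in> (borel :: baire measure) \<rightarrow>\<^sub>M M"
    and inv: "\<And>x. x \<in> space M \<Longrightarrow> \<psi> (\<phi> x) = x"
    using standard_borel_coding[OF M False] by blast
  note [measurable] = E
  have [measurable]: "col j \<in> borel \<rightarrow>\<^sub>M borel" for j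
    by (rule borel_measurable_continuous_onI[OF continuous_on_col])
  define P where "P = {(a, b). (\<forall>i. \<phi> (\<psi> a) i = a i) \<and> (\<forall>i. \<phi> (\<psi> b) i = b i) \<and> (\<psi> a, \<psi> b) \<in> E}"
  define Q where "Q = {\<alpha>. (\<forall>i. \<phi> (\<psi> (col 0 \<alpha>)) i = col 0 \<alpha> i) \<and> (\<forall>i. \<phi> (\<psi> (col 1 \<alpha>)) i = col 1 \<alpha> i) \<and>
      (\<psi> (col 0 \<alpha>), \<psi> (col 1 \<alpha>)) \<in> E}"
  have "Measurable.pred borel (\<lambda>\<alpha>. \<alpha> \<in> Q)" unfolding Q_def mem_Collect_eq by measurable
  then have "analytic Q" by (intro borel_imp_analytic) (simp add: pred_def)
  then have "analytic ((\<lambda>\<alpha>. (col 0 \<alpha>, col 1 \<alpha>)) ` Q)"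
    by (rule analytic_image) (intro continuous_on_Pair continuous_on_col)
  also have "(\<lambda>\<alpha>. (col 0 \<alpha>, col 1 \<alpha>)) ` Q = P"
  proof
    show "(\<lambda>\<alpha>. (col 0 \<alpha>, col 1 \<alpha>)) ` Q \<subseteq> P" unfolding Q_def P_def by auto
    show "P \<subseteq> (\<lambda>\<alpha>. (col 0 \<alpha>, col 1 \<alpha>)) ` Q"
    proof clarify
      fix a b assume ab: "(a, b) \<in> P"
      define \<alpha> where "\<alpha> = merge (\<lambda>n. if n = 0 then a else b)"
      have "col 0 \<alpha> = a" "col 1 \<alpha> = b" by (simp_all add: \<alpha>_def)
      then have "\<alpha> \<in> Q" "(a, b) = (col 0 \<alpha>, col 1 \<alpha>)" using ab by (simp_all add: P_def Q_def)
      then show "(a, b) \<in> (\<lambda>\<alpha>. (col 0 \<alpha>, col 1 \<alpha>)) ` Q" by blast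
    qed
  qed
  finally have P: "analytic P" .
  have "countable {b. (a, b) \<in> P}" for a
  proof -
    have "\<psi> a \<in> space M" using measurable_space[OF \<psi>] by simp
    then have "countable (\<phi> ` {y. (\<psi> a, y) \<in> E})" by (intro countable_image ctbl)
    moreover have "{b. (a, b) \<in> P} \<subseteq> \<phi> ` {y. (\<psi> a, y) \<in> E}"
    proof
      fix b assume "b \<in> {b. (a, b) \<in> P}"
      then have "(\<psi> a, \<psi> b) \<in> E" "b = \<phi> (\<psi> b)" by (auto simp: P_def fun_eq_iff)
      then show "b \<in> \<phi> ` {y. (\<psi> a, y) \<in> E}" by blast
    qed
    ultimately show ?thesis by (rule countable_subset[rotated])
  qed
  from lusin_novikov_baire[OF P this] obtain g :: "nat \<Rightarrow> baire \<Rightarrow> baire" where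
    g: "\<And>n. g n \<in> borel \<rightarrow>\<^sub>M borel" "\<And>x y. (x, y) \<in> P \<Longrightarrow> \<exists>n. y = g n x"
    by metis
  note g(1)[measurable]
  have "(\<lambda>x. \<psi> (g n (\<phi> x))) \<in> M \<rightarrow>\<^sub>M M" for n by measurable
  moreover have "\<exists>n. y = \<psi> (g n (\<phi> x))" if xy: "(x, y) \<in> E" for x y
  proof -
    have sp: "x \<in> space M" "y \<in> space M"
      using sets.sets_into_space[OF E] xy by (auto simp: space_pair_measure)
    then have "(\<phi> x, \<phi> y) \<in> P" using xy inv by (simp add: P_def)
    then obtain n where "\<phi> y = g n (\<phi> x)" using g(2) by blast
    then show ?thesis using inv[OF sp(2)] by metis
  qed
  ultimately show ?thesis by (rule that[of "\<lambda>n x. \<psi> (g n (\<phi> x))"])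
qed

section \<open>Hyperplanes in median graphs\<close>

definition cls :: "('a \<times> 'a) set \<Rightarrow> 'a \<Rightarrow> 'a set" where
  "cls G x = {y. (x, y) \<in> G\<^sup>*}"

definition between :: "('a \<times> 'a) set \<Rightarrow> 'a \<Rightarrow> 'a \<Rightarrow> 'a \<Rightarrow> bool" where
  "between G x m y \<longleftrightarrow> path_dist G x m + path_dist G m y = path_dist G x y"

text \<open>A hyperplane is represented by any of its edges \<open>(x, y)\<close>; these predicates are meaningful only
  within the connected component of \<open>x\<close>, where path distances are not junk values.\<close>

definition side :: "('a \<times> 'a) set \<Rightarrow> 'a \<Rightarrow> 'a \<Rightarrow> 'a \<Rightarrow> bool" where
  "side G x y z \<longleftrightarrow> path_dist G z y < path_dist G z x"

definition sep :: "('a \<times> 'a) set \<Rightarrow> 'a \<Rightarrow> 'a \<Rightarrow> 'a \<Rightarrow> 'a \<Rightarrow> bool" where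
  "sep G x y u v \<longleftrightarrow> side G x y u \<noteq> side G x y v"

section \<open>The path metric and betweenness\<close>

locale sym_graph =
  fixes G :: "('a \<times> 'a) set"
  assumes sym_G: "sym G" and irrefl_G: "irrefl G"
begin

abbreviation d :: "'a \<Rightarrow> 'a \<Rightarrow> nat" where "d \<equiv> path_dist G"

lemma cls_refl [simp]: "x \<in> cls G x"
  by (simp add: cls_def)

lemma cls_sym: "y \<in> cls G x \<longleftrightarrow> x \<in> cls G y"
  using sym_rtrancl[OF sym_G] by (auto simp: cls_def dest: symD)

lemma cls_eq: "y \<in> cls G x \<Longrightarrow> cls G y = cls G x"
  using cls_sym[of y x] by (auto simp: cls_def)

lemma edge_sym: "(x, y) \<in> G \<Longrightarrow> (y, x) \<in> G"
  using sym_G by (auto dest: symD)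

lemma edge_cls: "(x, y) \<in> G \<Longrightarrow> y \<in> cls G x"
  by (auto simp: cls_def)

lemma cls_step: "y \<in> cls G x \<Longrightarrow> (y, z) \<in> G \<Longrightarrow> z \<in> cls G x"
  by (auto simp: cls_def)

lemma relpow_sym: "(x, y) \<in> G ^^ n \<Longrightarrow> (y, x) \<in> G ^^ n"
proof (induction n arbitrary: x y)
  case (Suc n)
  then obtain z where "(x, z) \<in> G ^^ n" "(z, y) \<in> G" by auto
  show ?case by (rule relpow_Suc_I2[OF edge_sym[OF \<open>(z, y) \<in> G\<close>] Suc.IH[OF \<open>(x, z) \<in> G ^^ n\<close>]])
qed auto

lemma relpow_d: "y \<in> cls G x \<Longrightarrow> (x, y) \<in> G ^^ d x y"
  unfolding path_dist_def cls_def by (rule LeastI_ex) (auto dest: rtrancl_imp_relpow)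

lemma d_le: "(x, y) \<in> G ^^ n \<Longrightarrow> d x y \<le> n"
  unfolding path_dist_def by (rule Least_le)

lemma d_refl [simp]: "d x x = 0"
  using d_le[of x x 0] by simp

lemma d_sym: "d x y = d y x"
proof -
  have "(x, y) \<in> G ^^ n \<longleftrightarrow> (y, x) \<in> G ^^ n" for n using relpow_sym by blast
  then show ?thesis by (simp add: path_dist_def)
qed

lemma d_triangle:
  assumes "y \<in> cls G x" "z \<in> cls G y"
  shows "d x z \<le> d x y + d y z"
proof -
  have "(x, z) \<in> G ^^ (d x y + d y z)"
    unfolding relpow_add using relpow_d[OF assms(1)] relpow_d[OF assms(2)] by blast
  then show ?thesis by (rule d_le)
qed

lemma d_triangle':
  assumes "x \<in> cls G w" "y \<in> cls G w" "z \<in> cls G w"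
  shows "d x z \<le> d x y + d y z"
  using d_triangle[of y x z] assms cls_eq[OF assms(1)] cls_eq[OF assms(2)] by simp

lemma d_eq_0: "y \<in> cls G x \<Longrightarrow> d x y = 0 \<Longrightarrow> x = y"
  using relpow_d[of y x] by simp

lemma d_edge: "(x, y) \<in> G \<Longrightarrow> d x y = 1"
proof -
  assume e: "(x, y) \<in> G"
  then have "d x y \<le> 1" by (intro d_le) simp
  moreover have "d x y \<noteq> 0" using d_eq_0[OF edge_cls[OF e]] e irrefl_G by (auto simp: irrefl_def)
  ultimately show ?thesis by simp
qed

lemma geodesic_step:
  assumes "y \<in> cls G x" "x \<noteq> y"
  obtains v where "(x, v) \<in> G" "d x y = Suc (d v y)"
proof -
  obtain n where n: "d x y = Suc n" using assms d_eq_0[of y x] by (cases "d x y") auto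
  have "(x, y) \<in> G ^^ Suc n" using relpow_d[OF assms(1)] n by simp
  then obtain v where v: "(x, v) \<in> G" "(v, y) \<in> G ^^ n" by (meson relpow_Suc_D2)
  have "y \<in> cls G v" using assms(1) cls_eq[OF edge_cls[OF v(1)]] by simp
  then have "d x y \<le> 1 + d v y" using d_triangle[OF edge_cls[OF v(1)]] d_edge[OF v(1)] by simp
  then show ?thesis using that[OF v(1)] n d_le[OF v(2)] by simp
qed

lemma between_commute: "between G x m y \<longleftrightarrow> between G y m x"
  by (auto simp: between_def d_sym)

lemma between_trans:
  assumes "a \<in> cls G w" "p \<in> cls G w" "n \<in> cls G w" "x \<in> cls G w"
    and "between G a p x" "between G p n x"
  shows "between G a n x"
  using assms(5,6) d_triangle'[OF assms(1,2,3)] d_triangle'[OF assms(1,3,4)]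
  unfolding between_def by linarith

lemma between_inner:
  assumes "a \<in> cls G w" "p \<in> cls G w" "c \<in> cls G w" "b \<in> cls G w"
    and "between G a c b" "between G a p c"
  shows "between G p c b"
  using assms(5,6) d_triangle'[OF assms(1,2,4)] d_triangle'[OF assms(2,3,4)]
  unfolding between_def by linarith

lemma sep_commute: "sep G x y u v \<longleftrightarrow> sep G x y v u"
  by (auto simp: sep_def)

lemma side_edge: "(x, y) \<in> G \<Longrightarrow> side G x y y \<and> \<not> side G x y x"
  using d_edge[of x y] by (simp add: side_def d_sym)

end

section \<open>Half-spaces given by edges\<close>

locale componentwise_median = sym_graph +
  assumes median: "\<And>x y z. y \<in> cls G x \<Longrightarrow> z \<in> cls G x \<Longrightarrow>
    \<exists>!m. m \<in> cls G x \<and> between G x m y \<and> between G y m z \<and> between G z m x"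
begin

lemma obtain_median:
  assumes "x \<in> cls G w" "y \<in> cls G w" "z \<in> cls G w"
  obtains m where "m \<in> cls G w" "between G x m y" "between G y m z" "between G z m x"
  using median[of y x z] cls_eq[OF assms(1)] assms that by auto

lemma median_unique:
  assumes "x \<in> cls G w" "y \<in> cls G w" "z \<in> cls G w" "m \<in> cls G w" "m' \<in> cls G w"
    "between G x m y" "between G y m z" "between G z m x"
    "between G x m' y" "between G y m' z" "between G z m' x"
  shows "m = m'"
  using median[of y x z] cls_eq[OF assms(1)] assms(2-) by auto

text \<open>The median of \<open>x\<close>, \<open>y\<close> and \<open>z\<close> lies between the
  ends of the edge, so it is one of them, and that end is nearer to \<open>z\<close> by exactly one.
  In other words, median graphs are bipartite.\<close>

lemma dist_edge_cases:
  assumes "(x, y) \<in> G" "z \<in> cls G x"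
  shows "d z x = Suc (d z y) \<or> d z y = Suc (d z x)"
proof -
  have y: "y \<in> cls G x" by (rule edge_cls[OF assms(1)])
  obtain m where m: "m \<in> cls G x" "between G x m y" "between G y m z" "between G z m x"
    using obtain_median[of x x y z] y assms(2) by auto
  have xy: "d x y = 1" by (rule d_edge[OF assms(1)])
  then consider "d x m = 0" | "d m y = 0" using m(2) unfolding between_def by linarith
  then show ?thesis
  proof cases
    case 1
    then have "m = x" using d_eq_0[OF m(1)] by simp
    then show ?thesis using m(3) xy by (simp add: between_def d_sym)
  next
    case 2
    then have "m = y" using d_eq_0[of y m] cls_eq[OF m(1)] y by simp
    then show ?thesis using m(4) xy by (simp add: between_def d_sym)
  qed
qed

lemma side_swap:
  assumes "(x, y) \<in> G" "z \<in> cls G x"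
  shows "side G y x z \<longleftrightarrow> \<not> side G x y z"
  using dist_edge_cases[OF assms] by (auto simp: side_def)

text \<open>If \<open>c\<close> lay on the \<open>x\<close>-side, then so would the median of \<open>a\<close>, \<open>b\<close>, \<open>x\<close>, obtained by first
  projecting \<open>x\<close> to \<open>[a, c]\<close> and to \<open>[c, b]\<close>; but this median agrees with that of \<open>a\<close>, \<open>b\<close>, \<open>y\<close>.\<close>

lemma side_convex:
  assumes xy: "(x, y) \<in> G" and cl: "a \<in> cls G x" "b \<in> cls G x" "c \<in> cls G x"
    and s: "side G x y a" "side G x y b" and bt: "between G a c b"
  shows "side G x y c"
proof (rule ccontr)
  assume "\<not> side G x y c"
  then have c: "d c y = Suc (d c x)" using dist_edge_cases[OF xy cl(3)] by (auto simp: side_def)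
  have a: "d a x = Suc (d a y)" using dist_edge_cases[OF xy cl(1)] s(1) by (auto simp: side_def)
  have b: "d b x = Suc (d b y)" using dist_edge_cases[OF xy cl(2)] s(2) by (auto simp: side_def)
  have x: "x \<in> cls G x" and y: "y \<in> cls G x" using edge_cls[OF xy] by auto
  obtain m where m: "m \<in> cls G x" "between G a m b" "between G b m y" "between G y m a"
    using obtain_median[OF cl(1,2) y] .
  have mx: "d m x = Suc (d m y)"
    using dist_edge_cases[OF xy m(1)] d_triangle'[OF cl(1) m(1) x] m(4) a d_sym[of y m] d_sym[of y a] d_sym[of m a]
    unfolding between_def by linarith
  \<comment> \<open>The vertices \<open>a\<close>, \<open>b\<close> and \<open>m\<close> are all one
    step nearer to \<open>y\<close> than to \<open>x\<close>, so \<open>m\<close>, lying on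
    geodesics to \<open>y\<close>, also lies on geodesics to \<open>x\<close>.\<close>
  have m': "between G b m x" "between G x m a"
    using m(3,4) mx a b by (simp_all add: between_def d_sym)
  obtain p where p: "p \<in> cls G x" "between G a p c" "between G c p x" "between G x p a"
    using obtain_median[OF cl(1,3) x] .
  obtain p' where p': "p' \<in> cls G x" "between G b p' c" "between G c p' x" "between G x p' b"
    using obtain_median[OF cl(2,3) x] .
  obtain n where n: "n \<in> cls G x" "between G p n p'" "between G p' n x" "between G x n p"
    using obtain_median[OF p(1) p'(1) x] .
  have pnx: "between G p n x" using n(4) between_commute by blast
  have "between G a n x"
    by (rule between_trans[OF cl(1) p(1) n(1) x _ pnx]) (use p(4) between_commute in blast)
  moreover have "between G b n x"
    by (rule between_trans[OF cl(2) p'(1) n(1) x _ n(3)]) (use p'(4) between_commute in blast)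
  moreover have "between G a n b"
  proof -
    have "between G b p a"
      by (rule between_trans[OF cl(2,3) p(1) cl(1)]) (use bt p(2) between_commute in blast)+
    then have apb: "between G a p b" using between_commute by blast
    have "between G p c b" by (rule between_inner[OF cl(1) p(1) cl(3,2) bt p(2)])
    then have pcb: "between G b c p" using between_commute by blast
    have "between G p p' b"
      by (rule between_trans[OF p(1) cl(3) p'(1) cl(2)]) (use pcb p'(2) between_commute in blast)+
    then have "between G b p' p" using between_commute by blast
    then have "between G b n p"
      by (rule between_trans[OF cl(2) p'(1) n(1) p(1)]) (use n(2) between_commute in blast)
    then have "between G p n b" using between_commute by blast
    then show ?thesis by (rule between_trans[OF cl(1) p(1) n(1) cl(2) apb])
  qed
  ultimately have "n = m"
    using median_unique[OF cl(1,2) x n(1) m(1)] m(2) m' between_commute by blast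
  \<comment> \<open>Being on a geodesic from \<open>c\<close> to \<open>x\<close> puts
    \<open>n\<close> on the x-side, whereas \<open>m\<close> is on the y-side.\<close>
  moreover have "between G c n x" by (rule between_trans[OF cl(3) p(1) n(1) x p(3) pnx])
  then have "d n x < d n y"
    using d_triangle'[OF cl(3) n(1) y] c unfolding between_def by linarith
  ultimately show False using mx by simp
qed

lemma not_side_convex:
  assumes xy: "(x, y) \<in> G" and cl: "a \<in> cls G x" "b \<in> cls G x" "c \<in> cls G x"
    and s: "\<not> side G x y a" "\<not> side G x y b" and bt: "between G a c b"
  shows "\<not> side G x y c"
  using side_convex[OF edge_sym[OF xy], of a b c] side_swap[OF xy] cls_eq[OF edge_cls[OF xy]] assms by auto

text \<open>By \<open>dist_edge_cases\<close>, one of \<open>u\<close> and \<open>v\<close> lies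
  between \<open>z\<close> and the other. If the two sides of \<open>z\<close> disagreed, convexity
  would then put \<open>u\<close> and \<open>v\<close> on the same side of
  \<open>(x, y)\<close>.\<close>

lemma side_parallel:
  assumes xy: "(x, y) \<in> G" and uv: "(u, v) \<in> G" and u: "u \<in> cls G x"
    and s: "\<not> side G x y u" "side G x y v" and z: "z \<in> cls G x"
  shows "side G u v z \<longleftrightarrow> side G x y z"
proof -
  have v: "v \<in> cls G x" using edge_cls[OF uv] cls_eq[OF u] by simp
  have zu: "z \<in> cls G u" using z cls_eq[OF u] by simp
  have duv: "d u v = 1" by (rule d_edge[OF uv])
  show ?thesis
  proof
    assume "side G u v z"
    then have "between G z v u"
      using dist_edge_cases[OF uv zu] duv by (auto simp: side_def between_def d_sym)
    then show "side G x y z" using not_side_convex[OF xy z u v _ s(1)] s(2) by blast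
  next
    assume z': "side G x y z"
    show "side G u v z"
    proof (rule ccontr)
      assume "\<not> side G u v z"
      then have "between G z u v"
        using dist_edge_cases[OF uv zu] duv by (auto simp: side_def between_def d_sym)
      then show False using side_convex[OF xy z v u z' s(2)] s(1) by blast
    qed
  qed
qed

lemma side_of_sep:
  assumes xy: "(x, y) \<in> G" and uv: "(u, v) \<in> G" and u: "u \<in> cls G x" and s: "sep G x y u v"
  shows "(\<forall>z\<in>cls G x. side G u v z \<longleftrightarrow> side G x y z) \<and> \<not> side G x y u \<and> side G x y v \<or>
         (\<forall>z\<in>cls G x. side G u v z \<longleftrightarrow> \<not> side G x y z) \<and> side G x y u \<and> \<not> side G x y v"
proof (cases "side G x y u")
  case False
  then show ?thesis using s side_parallel[OF xy uv u] by (auto simp: sep_def)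
next
  case True
  have v: "v \<in> cls G x" using edge_cls[OF uv] cls_eq[OF u] by simp
  have "side G v u z \<longleftrightarrow> side G x y z" if "z \<in> cls G x" for z
    by (rule side_parallel[OF xy edge_sym[OF uv] v]) (use True s that in \<open>auto simp: sep_def\<close>)
  moreover have "side G v u z \<longleftrightarrow> \<not> side G u v z" if "z \<in> cls G x" for z
    by (rule side_swap[OF uv]) (use that cls_eq[OF u] in simp)
  ultimately show ?thesis using True s by (auto simp: sep_def)
qed

text \<open>For edges of one component, \<open>sep G x y u v\<close> expresses that they belong to
  the same hyperplane. Together with \<open>sep_edge_sym\<close> this makes notions built on
  \<open>sep\<close> independent of the representing edge.\<close>

lemma sep_cong:
  assumes xy: "(x, y) \<in> G" and uv: "(u, v) \<in> G" and u: "u \<in> cls G x" and s: "sep G x y u v"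
    and "a \<in> cls G x" "b \<in> cls G x"
  shows "sep G u v a b \<longleftrightarrow> sep G x y a b"
  using side_of_sep[OF xy uv u s] assms(5,6) unfolding sep_def by blast

lemma sep_edge_sym:
  assumes xy: "(x, y) \<in> G" and uv: "(u, v) \<in> G" and u: "u \<in> cls G x" and s: "sep G x y u v"
  shows "sep G u v x y"
proof -
  have "sep G x y x y" using side_edge[OF xy] by (simp add: sep_def)
  then show ?thesis using sep_cong[OF assms, of x y] edge_cls[OF xy] by simp
qed

end

section \<open>Subtrees from colourings of hyperplanes\<close>

definition sim :: "('a \<times> 'a) set \<Rightarrow> ('a \<Rightarrow> 'a \<Rightarrow> nat) \<Rightarrow> nat \<Rightarrow> 'a \<Rightarrow> 'a \<Rightarrow> bool" where
  "sim G c n x y \<longleftrightarrow> (\<forall>u\<in>cls G x. \<forall>v\<in>cls G x. (u, v) \<in> G \<and> sep G u v x y \<longrightarrow> c u v < n)"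

text \<open>The classes of level \<open>Suc (c x y)\<close> cut the hyperplane of
  \<open>(x, y)\<close> into pieces, and this is the piece that contains \<open>(x, y)\<close>. One
  edge of each piece will be kept.\<close>

definition edge_rel :: "('a \<times> 'a) set \<Rightarrow> ('a \<Rightarrow> 'a \<Rightarrow> nat) \<Rightarrow> 'a \<Rightarrow> 'a \<Rightarrow> 'a \<Rightarrow> 'a \<Rightarrow> bool" where
  "edge_rel G c x y u v \<longleftrightarrow> (u, v) \<in> G \<and> sep G x y u v \<and> sim G c (Suc (c x y)) x u"

text \<open>A class of \<open>edge_rel\<close> contains its edges in both orientations;
  \<open>ch\<close> picks a single oriented edge, so the result is symmetrized.\<close>

definition chosen_graph :: "('a \<times> 'a) set \<Rightarrow> ('a \<Rightarrow> 'a \<Rightarrow> bool) \<Rightarrow> ('a \<times> 'a) set" where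
  "chosen_graph G ch = {(x, y) \<in> G. ch x y \<or> ch y x}"

section \<open>Finiteness of the set of separating edges\<close>

locale finite_hyperplane_median = componentwise_median +
  assumes finite_hyperplane: "\<And>x y. (x, y) \<in> G \<Longrightarrow>
    finite {(u, v) \<in> G. u \<in> cls G x \<and> \<not> side G x y u \<and> side G x y v}"
begin

lemma finite_sep_edges:
  assumes xy: "(x, y) \<in> G"
  shows "finite {(u, v) \<in> G. u \<in> cls G x \<and> sep G x y u v}"
proof -
  let ?P = "{(u, v) \<in> G. u \<in> cls G x \<and> \<not> side G x y u \<and> side G x y v}"
  have "{(u, v) \<in> G. u \<in> cls G x \<and> sep G x y u v} \<subseteq> ?P \<union> ?P\<inverse>"
    by (auto simp: sep_def edge_sym dest: cls_step)
  then show ?thesis using finite_hyperplane[OF xy] by (meson finite_Un finite_converse finite_subset)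
qed

text \<open>Along a path, a new edge \<open>(y, z)\<close> can add only the finitely many edges of
  its own hyperplane.\<close>

lemma finite_separating:
  assumes "(x, y) \<in> G\<^sup>*"
  shows "finite {(u, v) \<in> G. u \<in> cls G x \<and> sep G u v x y}"
  using assms
proof induction
  case base
  then show ?case by (simp add: sep_def)
next
  case (step y z)
  have y: "y \<in> cls G x" using step(1) by (simp add: cls_def)
  have "{(u, v) \<in> G. u \<in> cls G x \<and> sep G u v x z}
      \<subseteq> {(u, v) \<in> G. u \<in> cls G x \<and> sep G u v x y} \<union> {(u, v) \<in> G. u \<in> cls G y \<and> sep G y z u v}"
  proof clarify
    fix u v assume uv: "(u, v) \<in> G" "u \<in> cls G x" "sep G u v x z"
      and n: "\<not> (u \<in> cls G y \<and> sep G y z u v)"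
    have yu: "y \<in> cls G u" using y cls_eq[OF uv(2)] by simp
    have "u \<in> cls G y" using uv(2) cls_eq[OF y] by simp
    then have "\<not> sep G u v y z" using sep_edge_sym[OF uv(1) step(2) yu] n by blast
    then show "sep G u v x y" using uv(3) by (auto simp: sep_def)
  qed
  then show ?case using step.IH finite_sep_edges[OF step(2)] by (meson finite_Un finite_subset)
qed

end

locale hyperplane_colouring = finite_hyperplane_median +
  fixes c :: "'a \<Rightarrow> 'a \<Rightarrow> nat"
  assumes c_parallel: "\<And>x y u v. (x, y) \<in> G \<Longrightarrow> (u, v) \<in> G \<Longrightarrow> u \<in> cls G x \<Longrightarrow> sep G x y u v \<Longrightarrow> c u v = c x y"
begin

lemma sim_refl: "sim G c n x x"
  by (auto simp: sim_def sep_def)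

lemma sim_sym: "y \<in> cls G x \<Longrightarrow> sim G c n x y \<Longrightarrow> sim G c n y x"
  using cls_eq[of y x] sep_commute by (auto simp: sim_def)

lemma sim_trans:
  assumes "y \<in> cls G x" "sim G c n x y" "sim G c n y z"
  shows "sim G c n x z"
  using assms(2,3) unfolding sim_def cls_eq[OF assms(1)] by (auto simp: sep_def)

text \<open>The only hyperplane separating the ends of an edge is its own.\<close>

lemma sim_edge: "(x, y) \<in> G \<Longrightarrow> c x y < n \<Longrightarrow> sim G c n x y"
  unfolding sim_def
proof (intro ballI impI)
  fix u v assume xy: "(x, y) \<in> G" "c x y < n" and u: "u \<in> cls G x" and uv: "(u, v) \<in> G \<and> sep G u v x y"
  have x: "x \<in> cls G u" using u cls_sym by blast
  have "c x y = c u v" by (rule c_parallel[OF _ xy(1) x]) (use uv in auto)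
  then show "c u v < n" using xy(2) by simp
qed

lemma edge_rel_sym:
  assumes "(x, y) \<in> G" "u \<in> cls G x" "edge_rel G c x y u v"
  shows "edge_rel G c u v x y"
  using assms sep_edge_sym[OF assms(1) _ assms(2)] c_parallel[OF assms(1) _ assms(2)] sim_sym[OF assms(2)]
  by (auto simp: edge_rel_def)

lemma edge_rel_trans:
  assumes xy: "(x, y) \<in> G" and u: "u \<in> cls G x" and a: "a \<in> cls G x"
    and r: "edge_rel G c x y u v" "edge_rel G c u v a b"
  shows "edge_rel G c x y a b"
proof -
  have uv: "(u, v) \<in> G" "sep G x y u v" and ab: "(a, b) \<in> G" "sep G u v a b"
    using r by (auto simp: edge_rel_def)
  have "b \<in> cls G x" using edge_cls[OF ab(1)] cls_eq[OF a] by simp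
  then have "sep G x y a b" using sep_cong[OF xy uv(1) u uv(2) a] ab(2) by simp
  then show ?thesis
    using r ab sim_trans[OF u] c_parallel[OF xy uv(1) u uv(2)] by (auto simp: edge_rel_def)
qed

end

text \<open>In \<open>c_crossing\<close>, the hyperplane of \<open>(p, q)\<close> separates two
  endpoints, on the same side, of edges of the hyperplane of \<open>(u, v)\<close>; this is the form
  in which crossing is used.\<close>

locale tree_choice = hyperplane_colouring +
  fixes ch :: "'a \<Rightarrow> 'a \<Rightarrow> bool"
  assumes c_crossing: "\<And>u v u' v' p q. (u, v) \<in> G \<Longrightarrow> (u', v') \<in> G \<Longrightarrow> u' \<in> cls G u \<Longrightarrow>
      \<not> side G u v u' \<Longrightarrow> side G u v v' \<Longrightarrow> (p, q) \<in> G \<Longrightarrow> p \<in> cls G u \<Longrightarrow> sep G p q u u' \<Longrightarrow> c p q \<noteq> c u v"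
    and ch_ex: "\<And>x y. (x, y) \<in> G \<Longrightarrow> \<exists>u\<in>cls G x. \<exists>v\<in>cls G x. edge_rel G c x y u v \<and> ch u v"
    and ch_unique: "\<And>x y u v u' v'. (x, y) \<in> G \<Longrightarrow> u \<in> cls G x \<Longrightarrow> u' \<in> cls G x \<Longrightarrow>
      edge_rel G c x y u v \<Longrightarrow> ch u v \<Longrightarrow> edge_rel G c x y u' v' \<Longrightarrow> ch u' v' \<Longrightarrow> u = u' \<and> v = v'"
begin

abbreviation T :: "('a \<times> 'a) set" where "T \<equiv> chosen_graph G ch"

lemma sym_T: "sym T"
  using edge_sym by (auto simp: chosen_graph_def intro!: symI)

text \<open>If \<open>K\<close> is the largest colour on a cycle, the whole cycle lies in one class
  of level \<open>Suc K\<close>, and going round it crosses the hyperplane of an edge of colour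
  \<open>K\<close> a second time. Both edges were chosen from the same class of
  \<open>edge_rel\<close>, so they coincide up to orientation, against the distinctness of the
  vertices.\<close>

lemma acyclic_T: "acyclic_graph T"
  unfolding acyclic_graph_def
proof
  assume "\<exists>p. graph_cycle T p"
  then obtain p where "graph_cycle T p" ..
  define n where "n = length p"
  \<comment> \<open>Indices are read modulo \<open>n\<close>, so that the cycle can be started at an
    edge of largest colour.\<close>
  define P where "P i = p ! (i mod n)" for i
  have n3: "3 \<le> n" using \<open>graph_cycle T p\<close> by (simp add: graph_cycle_def n_def)
  have modlt: "i mod n < n" for i using n3 by (intro mod_less_divisor) linarith
  have T: "(P i, P (Suc i)) \<in> T" for i
  proof -
    have "i mod n < length p" using modlt[of i] by (simp only: n_def)
    then have "(p ! (i mod n), p ! (Suc (i mod n) mod length p)) \<in> T"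
      using \<open>graph_cycle T p\<close> unfolding graph_cycle_def by blast
    then show ?thesis by (simp add: P_def n_def mod_Suc_eq)
  qed
  have inj: "i mod n = j mod n" if "P i = P j" for i j
  proof -
    have "i mod n < length p" "j mod n < length p" using modlt by (simp_all only: n_def)
    then show ?thesis using that \<open>graph_cycle T p\<close>
      by (simp add: P_def graph_cycle_def nth_eq_iff_index_eq)
  qed
  have G: "(P i, P (Suc i)) \<in> G" for i using T[of i] by (simp add: chosen_graph_def)
  have per: "P (i + n) = P i" for i by (simp add: P_def)
  define K where "K = Max ((\<lambda>i. c (P i) (P (Suc i))) ` {..<n})"
  have Kmod: "c (P i) (P (Suc i)) = c (P (i mod n)) (P (Suc (i mod n)))" for i
    by (simp add: P_def mod_Suc_eq)
  have K: "c (P i) (P (Suc i)) \<le> K" for i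
    unfolding K_def by (subst Kmod, rule Max_ge) (use modlt in auto)
  have "K \<in> (\<lambda>i. c (P i) (P (Suc i))) ` {..<n}" unfolding K_def by (rule Max_in) (use modlt[of 0] in auto)
  then obtain i0 where i0: "c (P i0) (P (Suc i0)) = K" by auto
  let ?x = "P i0" and ?y = "P (Suc i0)"
  have sim: "P (i0 + k) \<in> cls G ?x \<and> sim G c (Suc K) ?x (P (i0 + k))" for k
  proof (induction k)
    case 0
    then show ?case by (simp add: sim_refl)
  next
    case (Suc k)
    have "sim G c (Suc K) (P (i0 + k)) (P (Suc (i0 + k)))"
      by (rule sim_edge[OF G]) (use K[of "i0 + k"] in simp)
    then show ?case
      using Suc sim_trans[of "P (i0 + k)" ?x "Suc K" "P (Suc (i0 + k))"] cls_eq[of "P (i0 + k)" ?x]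
        edge_cls[OF G[of "i0 + k"]] by auto
  qed
  have "\<exists>k. 1 \<le> k \<and> k < n \<and> sep G ?x ?y (P (i0 + k)) (P (Suc (i0 + k)))"
  proof (rule ccontr)
    assume no: "\<not> ?thesis"
    have "side G ?x ?y (P (i0 + Suc k))" if "k < n" for k
      using that
    proof (induction k)
      case 0
      then show ?case using side_edge[OF G[of i0]] by simp
    next
      case (Suc k)
      then have "side G ?x ?y (P (i0 + Suc k))" by simp
      moreover have "\<not> sep G ?x ?y (P (i0 + Suc k)) (P (Suc (i0 + Suc k)))" using no Suc.prems by auto
      ultimately show ?case by (simp add: sep_def)
    qed
    from this[of "n - 1"] have "side G ?x ?y (P (i0 + n))" using n3 by simp
    then show False using side_edge[OF G[of i0]] per by simp
  qed
  then obtain k where k: "1 \<le> k" "k < n" "sep G ?x ?y (P (i0 + k)) (P (Suc (i0 + k)))" by blast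
  let ?u = "P (i0 + k)" and ?v = "P (Suc (i0 + k))"
  have u: "?u \<in> cls G ?x" using sim by blast
  have v: "?v \<in> cls G ?x" using edge_cls[OF G[of "i0 + k"]] cls_eq[OF u] by simp
  have y: "?y \<in> cls G ?x" using edge_cls[OF G[of i0]] .
  have su: "sim G c (Suc K) ?x ?u" and sv: "sim G c (Suc K) ?x ?v" and sy: "sim G c (Suc K) ?x ?y"
    using sim[of k] sim[of "Suc k"] sim[of 1] by simp_all
  have sxy: "sep G ?x ?y ?x ?y" using side_edge[OF G[of i0]] by (simp add: sep_def)
  have rel: "edge_rel G c ?x ?y ?x ?y" "edge_rel G c ?x ?y ?y ?x"
    "edge_rel G c ?x ?y ?u ?v" "edge_rel G c ?x ?y ?v ?u"
    using G[of i0] G[of "i0 + k"] edge_sym sxy k(3) sep_commute su sv sy sim_refl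
    by (auto simp: edge_rel_def i0)
  have "ch ?x ?y \<or> ch ?y ?x" "ch ?u ?v \<or> ch ?v ?u"
    using T[of i0] T[of "i0 + k"] by (auto simp: chosen_graph_def)
  then have "?x = ?u \<and> ?y = ?v \<or> ?x = ?v \<and> ?y = ?u"
    using ch_unique[OF G[of i0]] rel cls_refl[of ?x] u v y by metis
  then show False
  proof
    assume "?x = ?u \<and> ?y = ?v"
    then have "i0 mod n = (i0 + k) mod n" using inj by blast
    then have "n dvd k" by (metis add_diff_cancel_left' mod_eq_dvd_iff_nat le_add1)
    then show False using k nat_dvd_not_less by auto
  next
    assume eq: "?x = ?v \<and> ?y = ?u"
    \<comment> \<open>With opposite orientations \<open>n\<close> divides both k+1 and k-1, where 0
      < k < n, and this is possible only for n at most 2.\<close>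
    then have "i0 mod n = (i0 + Suc k) mod n" "Suc i0 mod n = (Suc i0 + (k - 1)) mod n"
      using inj[of i0 "Suc (i0 + k)"] inj[of "Suc i0" "i0 + k"] k(1) by simp_all
    then have "n dvd Suc k" "n dvd k - 1"
      by (metis add_diff_cancel_left' mod_eq_dvd_iff_nat le_add1)+
    then have "n \<le> Suc k" "k - 1 > 0 \<Longrightarrow> n \<le> k - 1" by (auto dest: dvd_imp_le)
    then show False using n3 k(1,2) by linarith
  qed
qed

text \<open>An edge of colour \<open>n\<close> is replaced by a detour through the chosen edge
  \<open>(a, b)\<close> of its piece. Both \<open>u\<close> and \<open>a\<close> are endpoints of
  edges of one hyperplane, on the same side, so no hyperplane of colour \<open>n\<close> separates
  them and the hypothesis at level \<open>n\<close> joins them; likewise for \<open>v\<close> and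
  \<open>b\<close>.\<close>

lemma edge_T_connected:
  assumes IH: "\<And>x y. y \<in> cls G x \<Longrightarrow> sim G c n x y \<Longrightarrow> (x, y) \<in> T\<^sup>*"
    and uv: "(u, v) \<in> G" and cn: "c u v \<le> n"
  shows "(u, v) \<in> T\<^sup>*"
proof (cases "c u v < n")
  case True
  then show ?thesis using IH[OF edge_cls[OF uv]] sim_edge[OF uv] by blast
next
  case False
  then have c: "c u v = n" using cn by simp
  obtain a' b' where ab': "a' \<in> cls G u" "b' \<in> cls G u" "edge_rel G c u v a' b'" "ch a' b'"
    using ch_ex[OF uv] by blast
  then have e': "(a', b') \<in> G" "sep G u v a' b'" "sim G c (Suc n) u a'" by (auto simp: edge_rel_def c)
  have "c a' b' = n" using c_parallel[OF uv e'(1) ab'(1) e'(2)] c by simp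
  then have "sim G c (Suc n) a' b'" using sim_edge[OF e'(1)] by simp
  then have sb: "sim G c (Suc n) u b'" by (rule sim_trans[OF ab'(1) e'(3)])
  \<comment> \<open>The chosen edge is turned so that \<open>a\<close> lies on the side of
    \<open>u\<close>.\<close>
  obtain a b where ab: "a \<in> cls G u" "b \<in> cls G u" "(a, b) \<in> T" "\<not> side G u v a" "side G u v b"
    "sim G c (Suc n) u a" "sim G c (Suc n) u b"
  proof (cases "side G u v b'")
    case True
    then show ?thesis using that[of a' b'] ab' e' sb by (auto simp: chosen_graph_def sep_def)
  next
    case False
    then show ?thesis using that[of b' a'] ab' e' sb edge_sym by (auto simp: chosen_graph_def sep_def)
  qed
  have abG: "(a, b) \<in> G" using ab(3) by (simp add: chosen_graph_def)
  have v: "v \<in> cls G u" using edge_cls[OF uv] .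
  have bv: "b \<in> cls G v" using ab(2) cls_eq[OF v] by simp
  have "sim G c n u a"
    unfolding sim_def
  proof (intro ballI impI)
    fix p q assume pq: "p \<in> cls G u" "q \<in> cls G u" "(p, q) \<in> G \<and> sep G p q u a"
    then have "c p q < Suc n" using ab(6) unfolding sim_def by blast
    moreover have "c p q \<noteq> c u v" by (rule c_crossing[OF uv abG ab(1,4,5)]) (use pq in auto)
    ultimately show "c p q < n" using c by simp
  qed
  then have ua: "(u, a) \<in> T\<^sup>*" by (rule IH[OF ab(1)])
  have "sim G c (Suc n) v b"
  proof (rule sim_trans[OF _ _ ab(7)])
    show "u \<in> cls G v" using v cls_sym by blast
    show "sim G c (Suc n) v u" by (rule sim_sym[OF v sim_edge[OF uv]]) (simp add: c)
  qed
  have "sim G c n v b"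
    unfolding sim_def
  proof (intro ballI impI)
    fix p q assume pq: "p \<in> cls G v" "q \<in> cls G v" "(p, q) \<in> G \<and> sep G p q v b"
    then have "c p q < Suc n" using \<open>sim G c (Suc n) v b\<close> unfolding sim_def by blast
    moreover have "c p q \<noteq> c v u"
    proof (rule c_crossing[OF edge_sym[OF uv] edge_sym[OF abG] bv])
      show "\<not> side G v u b" "side G v u a"
        using side_swap[OF uv] ab by auto
    qed (use pq in auto)
    moreover have "c v u = c u v"
      by (rule c_parallel[OF uv edge_sym[OF uv] v]) (use side_edge[OF uv] in \<open>simp add: sep_def\<close>)
    ultimately show "c p q < n" using c by simp
  qed
  then have "(v, b) \<in> T\<^sup>*" by (rule IH[OF bv])
  then have "(b, v) \<in> T\<^sup>*" using sym_rtrancl[OF sym_T] by (auto dest: symD)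
  then show ?thesis using ua ab(3) by (meson converse_rtrancl_into_rtrancl rtrancl_trans)
qed

text \<open>Every edge of a geodesic from \<open>x\<close> to \<open>y\<close> belongs to a
  hyperplane separating them, so at level n+1 it has colour at most n and
  \<open>edge_T_connected\<close> applies. At level 0 nothing separates the two vertices, so they
  are equal.\<close>

lemma sim_T_connected: "y \<in> cls G x \<Longrightarrow> sim G c n x y \<Longrightarrow> (x, y) \<in> T\<^sup>*"
proof (induction n arbitrary: x y)
  case 0
  have "x = y"
  proof (rule ccontr)
    assume "x \<noteq> y"
    then obtain v where v: "(x, v) \<in> G" "d x y = Suc (d v y)" using geodesic_step[OF 0(1)] by blast
    then have "sep G x v x y" using side_edge[OF v(1)] by (simp add: sep_def side_def d_sym)
    then show False using 0(2) v(1) edge_cls[OF v(1)] unfolding sim_def by auto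
  qed
  then show ?case by simp
next
  case (Suc n)
  have "(x, y) \<in> T\<^sup>*" if "y \<in> cls G x" "sim G c (Suc n) x y" "d x y = k" for x y k
    using that
  proof (induction k arbitrary: x)
    case 0
    then show ?case using d_eq_0[of y x] by simp
  next
    case (Suc k)
    then have "x \<noteq> y" by auto
    then obtain v where v: "(x, v) \<in> G" "d x y = Suc (d v y)" using geodesic_step[OF Suc.prems(1)] by blast
    then have "sep G x v x y" using side_edge[OF v(1)] by (simp add: sep_def side_def d_sym)
    then have cv: "c x v < Suc n" using Suc.prems(2) v(1) edge_cls[OF v(1)] unfolding sim_def by auto
    have xv: "x \<in> cls G v" "y \<in> cls G v" using edge_cls[OF v(1)] cls_sym cls_eq Suc.prems(1) by blast+
    have "sim G c (Suc n) v x" by (rule sim_sym[OF edge_cls[OF v(1)] sim_edge[OF v(1) cv]])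
    then have "sim G c (Suc n) v y" using Suc.prems(2) by (rule sim_trans[OF xv(1)])
    then have "(v, y) \<in> T\<^sup>*" using Suc.IH xv(2) v(2) Suc.prems(3) by simp
    moreover have "(x, v) \<in> T\<^sup>*"
      by (rule edge_T_connected[OF \<open>\<And>y x. y \<in> cls G x \<Longrightarrow> sim G c n x y \<Longrightarrow> (x, y) \<in> T\<^sup>*\<close> v(1)]) (use cv in auto)
    ultimately show ?case by (rule rtrancl_trans[rotated])
  qed
  then show ?case using Suc.prems by blast
qed

lemma connected_T: "T\<^sup>* = G\<^sup>*"
proof
  show "T\<^sup>* \<subseteq> G\<^sup>*" by (rule rtrancl_mono) (auto simp: chosen_graph_def)
  show "G\<^sup>* \<subseteq> T\<^sup>*"
  proof clarify
    fix x y assume xy: "(x, y) \<in> G\<^sup>*"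
    let ?S = "{(u, v) \<in> G. u \<in> cls G x \<and> sep G u v x y}"
    have "finite ((\<lambda>(u, v). c u v) ` ?S)" using finite_separating[OF xy] by (rule finite_imageI)
    then obtain n where n: "\<And>k. k \<in> (\<lambda>(u, v). c u v) ` ?S \<Longrightarrow> k < n"
      unfolding finite_nat_set_iff_bounded by blast
    have "sim G c n x y" unfolding sim_def using n by force
    then show "(x, y) \<in> T\<^sup>*" using xy by (intro sim_T_connected) (simp add: cls_def)
  qed
qed

end

section \<open>A definable colouring and a definable choice of edges\<close>

text \<open>Here \<open>k\<close> codes two words of equal length, that is, a basic open set of
  pairs of codes.\<close>

definition box :: "('a \<Rightarrow> baire) \<Rightarrow> nat \<Rightarrow> 'a \<Rightarrow> 'a \<Rightarrow> bool" where
  "box \<phi> k x y \<longleftrightarrow> (\<exists>m. k = to_nat (pre m (\<phi> x), pre m (\<phi> y)))"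

definition boundary :: "('a \<times> 'a) set \<Rightarrow> 'a \<Rightarrow> 'a \<Rightarrow> 'a \<Rightarrow> bool" where
  "boundary G x y a \<longleftrightarrow> (\<exists>b\<in>cls G x. (a, b) \<in> G \<and> sep G x y a b)"

text \<open>Crossing is tested on the boundary of one of the two hyperplanes. That boundary is
  finite, which leads directly to \<open>finite_crossing\<close>.\<close>

definition crossing :: "('a \<times> 'a) set \<Rightarrow> 'a \<Rightarrow> 'a \<Rightarrow> 'a \<Rightarrow> 'a \<Rightarrow> bool" where
  "crossing G x y p q \<longleftrightarrow> (\<exists>a\<in>cls G x. \<exists>a'\<in>cls G x. boundary G x y a \<and> boundary G x y a' \<and>
     \<not> sep G x y a a' \<and> sep G p q a a')"

text \<open>The colour of a hyperplane is (the code of) a basic open set which contains one of its edges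
  but no edge of the finitely many hyperplanes crossing it.\<close>

definition isolates :: "('a \<times> 'a) set \<Rightarrow> ('a \<Rightarrow> baire) \<Rightarrow> nat \<Rightarrow> 'a \<Rightarrow> 'a \<Rightarrow> bool" where
  "isolates G \<phi> k x y \<longleftrightarrow>
     (\<exists>u\<in>cls G x. \<exists>v\<in>cls G x. (u, v) \<in> G \<and> sep G x y u v \<and> box \<phi> k u v) \<and>
     (\<forall>p\<in>cls G x. \<forall>q\<in>cls G x. (p, q) \<in> G \<and> crossing G x y p q \<longrightarrow> \<not> box \<phi> k p q)"

definition hcol :: "('a \<times> 'a) set \<Rightarrow> ('a \<Rightarrow> baire) \<Rightarrow> 'a \<Rightarrow> 'a \<Rightarrow> nat" where
  "hcol G \<phi> x y = (LEAST k. isolates G \<phi> k x y)"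

text \<open>A Borel linear order that is not well-founded: least elements will be taken in finite
  sets only.\<close>

definition lexless :: "baire \<Rightarrow> baire \<Rightarrow> bool" where
  "lexless \<alpha> \<beta> \<longleftrightarrow> (\<exists>n. (\<forall>i<n. \<alpha> i = \<beta> i) \<and> \<alpha> n < \<beta> n)"

definition edge_code :: "('a \<Rightarrow> baire) \<Rightarrow> 'a \<Rightarrow> 'a \<Rightarrow> baire" where
  "edge_code \<phi> x y = merge (\<lambda>n. if n = 0 then \<phi> x else \<phi> y)"

definition least_edge :: "('a \<times> 'a) set \<Rightarrow> ('a \<Rightarrow> baire) \<Rightarrow> 'a \<Rightarrow> 'a \<Rightarrow> bool" where
  "least_edge G \<phi> x y \<longleftrightarrow> (\<forall>u\<in>cls G x. \<forall>v\<in>cls G x. edge_rel G (hcol G \<phi>) x y u v \<longrightarrow>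
     \<not> lexless (edge_code \<phi> u v) (edge_code \<phi> x y))"

lemma lexless_irrefl: "\<not> lexless \<alpha> \<alpha>"
  by (simp add: lexless_def)

lemma lexless_trans:
  assumes "lexless \<alpha> \<beta>" "lexless \<beta> \<gamma>"
  shows "lexless \<alpha> \<gamma>"
proof -
  obtain m where m: "\<forall>i<m. \<alpha> i = \<beta> i" "\<alpha> m < \<beta> m" using assms(1) by (auto simp: lexless_def)
  obtain n where n: "\<forall>i<n. \<beta> i = \<gamma> i" "\<beta> n < \<gamma> n" using assms(2) by (auto simp: lexless_def)
  have "\<forall>i<min m n. \<alpha> i = \<gamma> i" using m(1) n(1) by simp
  moreover have "\<alpha> (min m n) < \<gamma> (min m n)"
    using m n by (cases m n rule: linorder_cases) (auto simp: min_def)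
  ultimately show ?thesis unfolding lexless_def by blast
qed

lemma lexless_total: "\<alpha> \<noteq> \<beta> \<Longrightarrow> lexless \<alpha> \<beta> \<or> lexless \<beta> \<alpha>"
proof -
  assume "\<alpha> \<noteq> \<beta>"
  then have ex: "\<exists>i. \<alpha> i \<noteq> \<beta> i" by auto
  define n where "n = (LEAST i. \<alpha> i \<noteq> \<beta> i)"
  have "\<alpha> n \<noteq> \<beta> n" unfolding n_def by (rule LeastI_ex[OF ex])
  moreover have "\<forall>i<n. \<alpha> i = \<beta> i" unfolding n_def using not_less_Least by blast
  ultimately show ?thesis unfolding lexless_def by (metis linorder_neqE_nat)
qed

lemma edge_code_eq_iff: "edge_code \<phi> x y = edge_code \<phi> u v \<longleftrightarrow> \<phi> x = \<phi> u \<and> \<phi> y = \<phi> v"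
proof
  assume "edge_code \<phi> x y = edge_code \<phi> u v"
  then have "col n (edge_code \<phi> x y) = col n (edge_code \<phi> u v)" for n by simp
  from this[of 0] this[of 1] show "\<phi> x = \<phi> u \<and> \<phi> y = \<phi> v" by (simp add: edge_code_def)
qed (simp add: edge_code_def cong: if_cong)

lemma box_eq:
  assumes "box \<phi> (to_nat (pre m \<alpha>, pre m \<beta>)) x y"
  shows "pre m (\<phi> x) = pre m \<alpha> \<and> pre m (\<phi> y) = pre m \<beta>"
proof -
  obtain m' where "pre m \<alpha> = pre m' (\<phi> x)" "pre m \<beta> = pre m' (\<phi> y)"
    using assms by (auto simp: box_def)
  moreover have "m = m'" using arg_cong[OF \<open>pre m \<alpha> = pre m' (\<phi> x)\<close>, of length] by simp
  ultimately show ?thesis by simp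
qed

lemma eventually_pre_neq: "\<alpha> \<noteq> \<beta> \<Longrightarrow> eventually (\<lambda>m. pre m \<alpha> \<noteq> pre m \<beta>) sequentially"
proof -
  assume "\<alpha> \<noteq> \<beta>"
  then obtain i where "\<alpha> i \<noteq> \<beta> i" by auto
  have "pre m \<alpha> \<noteq> pre m \<beta>" if "m \<ge> Suc i" for m using that \<open>\<alpha> i \<noteq> \<beta> i\<close>
    unfolding pre_eq_iff by (meson Suc_le_lessD)
  then show ?thesis unfolding eventually_sequentially by blast
qed

section \<open>Colours and chosen edges in a coded median graph\<close>

locale coded_median = finite_hyperplane_median +
  fixes \<phi> :: "'a \<Rightarrow> baire"
  assumes inj_code: "inj_on \<phi> (Field G)"
begin

lemma crossing_parallel:
  assumes xy: "(x, y) \<in> G" and uv: "(u, v) \<in> G" and u: "u \<in> cls G x" and s: "sep G x y u v"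
  shows "crossing G u v p q \<longleftrightarrow> crossing G x y p q"
proof -
  have "boundary G u v a \<longleftrightarrow> boundary G x y a" if "a \<in> cls G x" for a
    using sep_cong[OF xy uv u s that] by (auto simp: boundary_def cls_eq[OF u])
  then show ?thesis
    using sep_cong[OF xy uv u s] by (auto simp: crossing_def cls_eq[OF u])
qed

lemma isolates_parallel:
  assumes xy: "(x, y) \<in> G" and uv: "(u, v) \<in> G" and u: "u \<in> cls G x" and s: "sep G x y u v"
  shows "isolates G \<phi> k u v \<longleftrightarrow> isolates G \<phi> k x y"
  using sep_cong[OF xy uv u s] by (auto simp: isolates_def cls_eq[OF u] crossing_parallel[OF xy uv u s])

text \<open>A hyperplane has finitely many boundary vertices, and any two of them are separated by
  only finitely many edges.\<close>

lemma finite_crossing: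
  assumes xy: "(x, y) \<in> G"
  shows "finite {(p, q) \<in> G. p \<in> cls G x \<and> crossing G x y p q}"
proof -
  define A where "A = {a \<in> cls G x. boundary G x y a}"
  define S where "S a a' = {(p, q) \<in> G. p \<in> cls G a \<and> sep G p q a a'}" for a a'
  have "A \<subseteq> fst ` {(u, v) \<in> G. u \<in> cls G x \<and> sep G x y u v}"
    by (force simp: A_def boundary_def)
  then have A: "finite A" using finite_sep_edges[OF xy] by (meson finite_imageI finite_subset)
  have cl: "cls G a = cls G x" if "a \<in> A" for a using that cls_eq by (simp add: A_def)
  have "finite (S a a')" if "a \<in> A" "a' \<in> A" for a a'
  proof -
    have "a' \<in> cls G a" unfolding cl[OF that(1)] using that(2) by (simp add: A_def)
    then show ?thesis unfolding S_def by (intro finite_separating) (simp add: cls_def)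
  qed
  then have "finite (\<Union>a\<in>A. \<Union>a'\<in>A. S a a')" using A by blast
  moreover have "{(p, q) \<in> G. p \<in> cls G x \<and> crossing G x y p q} \<subseteq> (\<Union>a\<in>A. \<Union>a'\<in>A. S a a')"
  proof clarify
    fix p q assume pq: "(p, q) \<in> G" "p \<in> cls G x" "crossing G x y p q"
    then obtain a a' where a: "a \<in> A" "a' \<in> A" "sep G p q a a'" by (auto simp: crossing_def A_def)
    then have "(p, q) \<in> S a a'" using pq(1,2) cl[OF a(1)] by (simp add: S_def)
    then show "(p, q) \<in> (\<Union>a\<in>A. \<Union>a'\<in>A. S a a')" using a(1,2) by blast
  qed
  ultimately show ?thesis by (rule finite_subset[rotated])
qed

text \<open>No hyperplane crosses itself, so each of the finitely many edges of crossing hyperplanes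
  differs from \<open>(x, y)\<close>, and sufficiently long initial words tell their codes
  apart.\<close>

lemma isolates_ex:
  assumes xy: "(x, y) \<in> G"
  shows "\<exists>k. isolates G \<phi> k x y"
proof -
  define S where "S = {(p, q) \<in> G. p \<in> cls G x \<and> crossing G x y p q}"
  have inj: "p = p'" if "(p, q) \<in> G \<or> (q, p) \<in> G" "(p', q') \<in> G \<or> (q', p') \<in> G" "\<phi> p = \<phi> p'" for p q p' q'
    using inj_code that by (auto simp: inj_on_def Field_def)
  have "eventually (\<lambda>m. \<not> (pre m (\<phi> p) = pre m (\<phi> x) \<and> pre m (\<phi> q) = pre m (\<phi> y))) sequentially"
    if "(p, q) \<in> S" for p q
  proof -
    have "(p, q) \<noteq> (x, y)" using that by (auto simp: S_def crossing_def)
    then have "\<phi> p \<noteq> \<phi> x \<or> \<phi> q \<noteq> \<phi> y" using inj[of p q x y] inj[of q p y x] that xy by (auto simp: S_def)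
    then show ?thesis
    proof
      assume "\<phi> p \<noteq> \<phi> x"
      from eventually_pre_neq[OF this] show ?thesis by (rule eventually_mono) simp
    next
      assume "\<phi> q \<noteq> \<phi> y"
      from eventually_pre_neq[OF this] show ?thesis by (rule eventually_mono) simp
    qed
  qed
  then have "\<forall>e\<in>S. eventually (\<lambda>m. \<not> (pre m (\<phi> (fst e)) = pre m (\<phi> x) \<and> pre m (\<phi> (snd e)) = pre m (\<phi> y))) sequentially"
    by auto
  then have "eventually (\<lambda>m. \<forall>e\<in>S. \<not> (pre m (\<phi> (fst e)) = pre m (\<phi> x) \<and> pre m (\<phi> (snd e)) = pre m (\<phi> y))) sequentially"
    using finite_crossing[OF xy] by (intro eventually_ball_finite) (auto simp: S_def)
  then obtain m where m: "\<And>p q. (p, q) \<in> S \<Longrightarrow> \<not> (pre m (\<phi> p) = pre m (\<phi> x) \<and> pre m (\<phi> q) = pre m (\<phi> y))"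
    unfolding eventually_sequentially by fastforce
  let ?k = "to_nat (pre m (\<phi> x), pre m (\<phi> y))"
  have "box \<phi> ?k x y" by (auto simp: box_def)
  moreover have "sep G x y x y" using side_edge[OF xy] by (simp add: sep_def)
  moreover have "\<not> box \<phi> ?k p q" if "p \<in> cls G x" "(p, q) \<in> G" "crossing G x y p q" for p q
    using m[of p q] box_eq[of \<phi> m "\<phi> x" "\<phi> y" p q] that by (auto simp: S_def)
  ultimately have "isolates G \<phi> ?k x y"
    unfolding isolates_def using xy edge_cls[OF xy] cls_refl by blast
  then show ?thesis ..
qed

lemma isolates_hcol: "(x, y) \<in> G \<Longrightarrow> isolates G \<phi> (hcol G \<phi> x y) x y"
  unfolding hcol_def by (rule LeastI_ex[OF isolates_ex])

lemma hyperplane_colouring_hcol: "hyperplane_colouring G (hcol G \<phi>)"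
proof
  fix x y u v assume "(x, y) \<in> G" "(u, v) \<in> G" "u \<in> cls G x" "sep G x y u v"
  then show "hcol G \<phi> u v = hcol G \<phi> x y" unfolding hcol_def using isolates_parallel by simp
qed

text \<open>If the colours agreed, the common box would contain an edge \<open>(a, b)\<close> of the
  hyperplane of \<open>(p, q)\<close>. This edge also separates \<open>u\<close> from
  \<open>u'\<close>, hence crosses \<open>(u, v)\<close> and must lie outside the box.\<close>

lemma hcol_crossing:
  assumes uv: "(u, v) \<in> G" and uv': "(u', v') \<in> G" and u': "u' \<in> cls G u"
    and s: "\<not> side G u v u'" "side G u v v'" and pq: "(p, q) \<in> G" and p: "p \<in> cls G u" and sep: "sep G p q u u'"
  shows "hcol G \<phi> p q \<noteq> hcol G \<phi> u v"
proof
  assume eq: "hcol G \<phi> p q = hcol G \<phi> u v"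
  obtain a b where ab: "a \<in> cls G p" "(a, b) \<in> G" "sep G p q a b" "box \<phi> (hcol G \<phi> p q) a b"
    using isolates_hcol[OF pq] unfolding isolates_def by blast
  have a: "a \<in> cls G u" using ab(1) cls_eq[OF p] by simp
  have u: "u \<in> cls G p" "u' \<in> cls G p" using u' cls_eq[OF p] by simp_all
  have "sep G a b u u'" using sep_cong[OF pq ab(2,1,3) u] sep by simp
  moreover have "boundary G u v u"
    using uv edge_cls[OF uv] side_edge[OF uv] by (auto simp: boundary_def sep_def)
  moreover have "boundary G u v u'"
    using uv' cls_step[OF u' uv'] s by (auto simp: boundary_def sep_def)
  moreover have "\<not> sep G u v u u'" using side_edge[OF uv] s by (simp add: sep_def)
  ultimately have "crossing G u v a b" using u' unfolding crossing_def by (meson cls_refl)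
  then show False
    using isolates_hcol[OF uv] a cls_step[OF a ab(2)] ab(2,4) eq unfolding isolates_def by auto
qed

text \<open>The classes of \<open>edge_rel\<close> are finite, so each has an edge of least code,
  which is unique by injectivity of \<phi>. Being least does not depend on the representing edge, by
  \<open>edge_rel_sym\<close> and \<open>edge_rel_trans\<close>.\<close>

lemma tree_choice_least_edge: "tree_choice G (hcol G \<phi>) (least_edge G \<phi>)"
proof -
  interpret hyperplane_colouring G "hcol G \<phi>" by (rule hyperplane_colouring_hcol)
  show ?thesis
  proof
    show "\<And>u v u' v' p q. (u, v) \<in> G \<Longrightarrow> (u', v') \<in> G \<Longrightarrow> u' \<in> cls G u \<Longrightarrow>
      \<not> side G u v u' \<Longrightarrow> side G u v v' \<Longrightarrow> (p, q) \<in> G \<Longrightarrow> p \<in> cls G u \<Longrightarrow> sep G p q u u' \<Longrightarrow>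
      hcol G \<phi> p q \<noteq> hcol G \<phi> u v"
      by (rule hcol_crossing)
  next
    fix x y assume xy: "(x, y) \<in> G"
    define C where "C = {(u, v). u \<in> cls G x \<and> edge_rel G (hcol G \<phi>) x y u v}"
    define r where "r e e' \<longleftrightarrow> lexless (edge_code \<phi> (fst e) (snd e)) (edge_code \<phi> (fst e') (snd e'))" for e e'
    have "C \<subseteq> {(u, v) \<in> G. u \<in> cls G x \<and> sep G x y u v}" by (auto simp: C_def edge_rel_def)
    then have "finite C" using finite_sep_edges[OF xy] by (rule finite_subset)
    moreover have "(x, y) \<in> C"
      using xy side_edge[OF xy] sim_refl by (simp add: C_def edge_rel_def sep_def)
    moreover have "asymp_on C r" "transp_on C r"
      unfolding r_def using lexless_trans lexless_irrefl
      by (auto intro!: asymp_onI transp_onI)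
    ultimately obtain m where m: "m \<in> C" "\<forall>e\<in>C. e \<noteq> m \<longrightarrow> \<not> r e m"
      using Finite_Set.bex_min_element[of C r] by blast
    have m': "\<not> r e m" if "e \<in> C" for e
      using m(2) that lexless_irrefl by (cases "e = m") (auto simp: r_def)
    obtain u v where uv: "m = (u, v)" by (cases m)
    have u: "u \<in> cls G x" "edge_rel G (hcol G \<phi>) x y u v" using m(1) uv by (auto simp: C_def)
    have v: "v \<in> cls G x" using u cls_step by (auto simp: edge_rel_def)
    have "least_edge G \<phi> u v"
      unfolding least_edge_def
    proof (intro ballI impI)
      fix a b assume "a \<in> cls G u" "b \<in> cls G u" and r: "edge_rel G (hcol G \<phi>) u v a b"
      then have a: "a \<in> cls G x" using cls_eq[OF u(1)] by simp
      then have "(a, b) \<in> C" using edge_rel_trans[OF xy u(1) a u(2) r] by (simp add: C_def)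
      from m'[OF this] show "\<not> lexless (edge_code \<phi> a b) (edge_code \<phi> u v)" by (simp add: r_def uv)
    qed
    then show "\<exists>u\<in>cls G x. \<exists>v\<in>cls G x. edge_rel G (hcol G \<phi>) x y u v \<and> least_edge G \<phi> u v"
      using u v by blast
  next
    fix x y u v u' v'
    assume xy: "(x, y) \<in> G" and u: "u \<in> cls G x" "u' \<in> cls G x"
      and r: "edge_rel G (hcol G \<phi>) x y u v" and l: "least_edge G \<phi> u v"
      and r': "edge_rel G (hcol G \<phi>) x y u' v'" and l': "least_edge G \<phi> u' v'"
    have uvG: "(u, v) \<in> G" "(u', v') \<in> G" using r r' by (auto simp: edge_rel_def)
    have cl: "cls G u = cls G x" "cls G u' = cls G x" using u cls_eq by blast+
    have v: "v \<in> cls G x" "v' \<in> cls G x" using u uvG cls_step by blast+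
    have x: "x \<in> cls G u" "x \<in> cls G u'" using cl by simp_all
    have "edge_rel G (hcol G \<phi>) u v u' v'"
      by (rule edge_rel_trans[OF uvG(1) x(1) _ edge_rel_sym[OF xy u(1) r] r']) (use cl u in simp)
    moreover have "edge_rel G (hcol G \<phi>) u' v' u v"
      by (rule edge_rel_trans[OF uvG(2) x(2) _ edge_rel_sym[OF xy u(2) r'] r]) (use cl u in simp)
    ultimately have "\<not> lexless (edge_code \<phi> u' v') (edge_code \<phi> u v)"
      "\<not> lexless (edge_code \<phi> u v) (edge_code \<phi> u' v')"
      using l l' u v unfolding least_edge_def cl by blast+
    then have "edge_code \<phi> u v = edge_code \<phi> u' v'" using lexless_total by blast
    then have "\<phi> u = \<phi> u'" "\<phi> v = \<phi> v'" by (simp_all add: edge_code_eq_iff)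
    then show "u = u' \<and> v = v'" using inj_code uvG by (auto simp: inj_on_def Field_def)
  qed
qed

end

section \<open>Measurability\<close>

lemma measurable_pre: "pre m \<in> borel \<rightarrow>\<^sub>M count_space UNIV"
proof -
  have "pre m -` {s} \<inter> space borel \<in> sets borel" for s
  proof (cases "length s = m")
    case True
    then have "pre m -` {s} \<inter> space borel = cyl s" by (auto simp: cyl_def)
    then show ?thesis using borel_closed[OF closed_cyl] by simp
  next
    case False
    then have "pre m -` {s} \<inter> space borel = {}" by auto
    then show ?thesis by simp
  qed
  then show ?thesis by (subst measurable_count_space_eq_countable) auto
qed

lemma
  fixes g h :: "'b \<Rightarrow> nat"
  assumes "g \<in> N \<rightarrow>\<^sub>M count_space UNIV" "h \<in> N \<rightarrow>\<^sub>M count_space UNIV"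
  shows pred_nat_eq: "Measurable.pred N (\<lambda>w. g w = h w)"
    and pred_nat_less: "Measurable.pred N (\<lambda>w. g w < h w)"
proof -
  have [measurable]: "g \<in> N \<rightarrow>\<^sub>M borel" "h \<in> N \<rightarrow>\<^sub>M borel"
    using assms measurable_cong_sets[OF refl sets_borel_eq_count_space] by blast+
  show "Measurable.pred N (\<lambda>w. g w = h w)" "Measurable.pred N (\<lambda>w. g w < h w)" by measurable
qed

locale borel_graph_enum =
  fixes M :: "'a measure" and G :: "('a \<times> 'a) set" and f :: "nat \<Rightarrow> 'a \<Rightarrow> 'a" and \<phi> :: "'a \<Rightarrow> baire"
  assumes G_sets: "G \<in> sets (M \<Otimes>\<^sub>M M)"
    and f_meas: "\<And>n. f n \<in> M \<rightarrow>\<^sub>M M"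
    and cls_enum: "\<And>x. x \<in> space M \<Longrightarrow> cls G x = range (\<lambda>n. f n x)"
    and \<phi>_meas: "\<phi> \<in> M \<rightarrow>\<^sub>M borel"
    and \<phi>_inj: "inj_on \<phi> (space M)"
begin

lemmas [measurable] = G_sets f_meas \<phi>_meas

text \<open>The functions \<open>f n\<close> turn a quantifier over a class into a countable one;
  the definitions of colour and chosen edge are unfolded to such quantifiers below.\<close>

lemma pred_cls_ex [measurable (raw)]:
  assumes a: "a \<in> N \<rightarrow>\<^sub>M M" and P: "\<And>n. Measurable.pred N (\<lambda>w. P w (f n (a w)))"
  shows "Measurable.pred N (\<lambda>w. \<exists>u\<in>cls G (a w). P w u)"
proof -
  have "(\<exists>u\<in>cls G (a w). P w u) \<longleftrightarrow> (\<exists>n. P w (f n (a w)))" if "w \<in> space N" for w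
    using cls_enum[OF measurable_space[OF a that]] by simp
  moreover have "Measurable.pred N (\<lambda>w. \<exists>n. P w (f n (a w)))" using P by measurable
  ultimately show ?thesis by (subst measurable_cong) auto
qed

lemma pred_cls_all [measurable (raw)]:
  assumes a: "a \<in> N \<rightarrow>\<^sub>M M" and P: "\<And>n. Measurable.pred N (\<lambda>w. P w (f n (a w)))"
  shows "Measurable.pred N (\<lambda>w. \<forall>u\<in>cls G (a w). P w u)"
proof -
  have "(\<forall>u\<in>cls G (a w). P w u) \<longleftrightarrow> (\<forall>n. P w (f n (a w)))" if "w \<in> space N" for w
    using cls_enum[OF measurable_space[OF a that]] by simp
  moreover have "Measurable.pred N (\<lambda>w. \<forall>n. P w (f n (a w)))" using P by measurable
  ultimately show ?thesis by (subst measurable_cong) auto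
qed

lemma measurable_code_coord [measurable (raw)]:
  assumes "a \<in> N \<rightarrow>\<^sub>M M"
  shows "(\<lambda>w. \<phi> (a w) i) \<in> N \<rightarrow>\<^sub>M count_space UNIV"
  by (rule measurable_compose[OF measurable_compose[OF assms \<phi>_meas] measurable_coord])

lemma pred_eq:
  assumes [measurable]: "a \<in> N \<rightarrow>\<^sub>M M" "b \<in> N \<rightarrow>\<^sub>M M"
  shows "Measurable.pred N (\<lambda>w. a w = b w)"
proof -
  have "a w = b w \<longleftrightarrow> (\<forall>i. \<phi> (a w) i = \<phi> (b w) i)" if "w \<in> space N" for w
    using inj_onD[OF \<phi>_inj, of "a w" "b w"] measurable_space[OF assms(1) that]
      measurable_space[OF assms(2) that] by (auto simp: fun_eq_iff)
  moreover have "Measurable.pred N (\<lambda>w. \<forall>i. \<phi> (a w) i = \<phi> (b w) i)"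
    by (intro pred_intros_countable pred_nat_eq measurable_code_coord assms)
  ultimately show ?thesis by (subst measurable_cong) auto
qed

lemma pred_G [measurable (raw)]:
  assumes [measurable]: "a \<in> N \<rightarrow>\<^sub>M M" "b \<in> N \<rightarrow>\<^sub>M M"
  shows "Measurable.pred N (\<lambda>w. (a w, b w) \<in> G)"
  by measurable

lemma pred_relpow:
  assumes "a \<in> N \<rightarrow>\<^sub>M M" "b \<in> N \<rightarrow>\<^sub>M M"
  shows "Measurable.pred N (\<lambda>w. (a w, b w) \<in> G ^^ n)"
  using assms
proof (induction n arbitrary: b)
  case 0
  then show ?case using pred_eq by simp
next
  case (Suc n)
  note [measurable] = Suc.prems
  \<comment> \<open>The last intermediate vertex may be sought in the class of the starting point,
    which is enumerated.\<close>
  have "(x, y) \<in> G ^^ Suc n \<longleftrightarrow> (\<exists>z\<in>cls G x. (x, z) \<in> G ^^ n \<and> (z, y) \<in> G)" for x y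
    by (auto simp: cls_def dest: relpow_imp_rtrancl)
  moreover have "Measurable.pred N (\<lambda>w. \<exists>z\<in>cls G (a w). (a w, z) \<in> G ^^ n \<and> (z, b w) \<in> G)"
  proof (rule pred_cls_ex[OF Suc.prems(1)])
    fix k
    have "(\<lambda>w. f k (a w)) \<in> N \<rightarrow>\<^sub>M M" by measurable
    from Suc.IH[OF Suc.prems(1) this] have [measurable]: "Measurable.pred N (\<lambda>w. (a w, f k (a w)) \<in> G ^^ n)" .
    show "Measurable.pred N (\<lambda>w. (a w, f k (a w)) \<in> G ^^ n \<and> (f k (a w), b w) \<in> G)" by measurable
  qed
  ultimately show ?case by presburger
qed

lemma measurable_path_dist [measurable (raw)]:
  assumes "a \<in> N \<rightarrow>\<^sub>M M" "b \<in> N \<rightarrow>\<^sub>M M"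
  shows "(\<lambda>w. path_dist G (a w) (b w)) \<in> N \<rightarrow>\<^sub>M count_space UNIV"
  unfolding path_dist_def using pred_relpow[OF assms] by measurable

lemma pred_side [measurable (raw)]:
  assumes [measurable]: "a \<in> N \<rightarrow>\<^sub>M M" "b \<in> N \<rightarrow>\<^sub>M M" "c \<in> N \<rightarrow>\<^sub>M M"
  shows "Measurable.pred N (\<lambda>w. side G (a w) (b w) (c w))"
  unfolding side_def by (intro pred_nat_less measurable_path_dist assms)

lemma pred_sep [measurable (raw)]:
  assumes [measurable]: "a \<in> N \<rightarrow>\<^sub>M M" "b \<in> N \<rightarrow>\<^sub>M M" "c \<in> N \<rightarrow>\<^sub>M M" "e \<in> N \<rightarrow>\<^sub>M M"
  shows "Measurable.pred N (\<lambda>w. sep G (a w) (b w) (c w) (e w))"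
  unfolding sep_def by measurable

lemma pred_box [measurable (raw)]:
  assumes [measurable]: "a \<in> N \<rightarrow>\<^sub>M M" "b \<in> N \<rightarrow>\<^sub>M M"
  shows "Measurable.pred N (\<lambda>w. box \<phi> k (a w) (b w))"
proof -
  have [measurable]: "(\<lambda>w. pre m (\<phi> (c w))) \<in> N \<rightarrow>\<^sub>M count_space UNIV" if "c \<in> N \<rightarrow>\<^sub>M M" for m c
    by (rule measurable_compose[OF measurable_compose[OF that \<phi>_meas] measurable_pre])
  \<comment> \<open>With the words as separate variables, the equation for \<open>k\<close> no
    longer involves the points, and countably many Borel conditions remain.\<close>
  have "box \<phi> k x y \<longleftrightarrow> (\<exists>m p q. k = to_nat (p, q) \<and> pre m (\<phi> x) = p \<and> pre m (\<phi> y) = q)" for x y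
    by (auto simp: box_def)
  then show ?thesis by simp
qed

lemma pred_boundary [measurable (raw)]:
  assumes [measurable]: "a \<in> N \<rightarrow>\<^sub>M M" "b \<in> N \<rightarrow>\<^sub>M M" "c \<in> N \<rightarrow>\<^sub>M M"
  shows "Measurable.pred N (\<lambda>w. boundary G (a w) (b w) (c w))"
  unfolding boundary_def by measurable

lemma pred_crossing [measurable (raw)]:
  assumes [measurable]: "a \<in> N \<rightarrow>\<^sub>M M" "b \<in> N \<rightarrow>\<^sub>M M" "c \<in> N \<rightarrow>\<^sub>M M" "e \<in> N \<rightarrow>\<^sub>M M"
  shows "Measurable.pred N (\<lambda>w. crossing G (a w) (b w) (c w) (e w))"
  unfolding crossing_def by measurable

lemma pred_isolates [measurable (raw)]:
  assumes [measurable]: "a \<in> N \<rightarrow>\<^sub>M M" "b \<in> N \<rightarrow>\<^sub>M M"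
  shows "Measurable.pred N (\<lambda>w. isolates G \<phi> k (a w) (b w))"
  unfolding isolates_def by measurable

lemma measurable_hcol [measurable (raw)]:
  assumes [measurable]: "a \<in> N \<rightarrow>\<^sub>M M" "b \<in> N \<rightarrow>\<^sub>M M"
  shows "(\<lambda>w. hcol G \<phi> (a w) (b w)) \<in> N \<rightarrow>\<^sub>M count_space UNIV"
  unfolding hcol_def by measurable

lemma pred_edge_rel [measurable (raw)]:
  assumes [measurable]: "a \<in> N \<rightarrow>\<^sub>M M" "b \<in> N \<rightarrow>\<^sub>M M" "c \<in> N \<rightarrow>\<^sub>M M" "e \<in> N \<rightarrow>\<^sub>M M"
  shows "Measurable.pred N (\<lambda>w. edge_rel G (hcol G \<phi>) (a w) (b w) (c w) (e w))"
proof -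
  have [measurable]: "Measurable.pred N (\<lambda>w. sim G (hcol G \<phi>) (Suc (hcol G \<phi> (a w) (b w))) (a w) (c w))"
    unfolding sim_def
  proof (intro pred_cls_all assms(1))
    fix m n
    have u [measurable]: "(\<lambda>w. f m (a w)) \<in> N \<rightarrow>\<^sub>M M" and v [measurable]: "(\<lambda>w. f n (a w)) \<in> N \<rightarrow>\<^sub>M M"
      by measurable
    have [measurable]: "Measurable.pred N (\<lambda>w. hcol G \<phi> (f m (a w)) (f n (a w)) < Suc (hcol G \<phi> (a w) (b w)))"
      by (intro pred_nat_less measurable_hcol u v measurable_compose[OF measurable_hcol[OF assms(1,2)]]) simp
    show "Measurable.pred N (\<lambda>w. (f m (a w), f n (a w)) \<in> G \<and> sep G (f m (a w)) (f n (a w)) (a w) (c w) \<longrightarrow>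
        hcol G \<phi> (f m (a w)) (f n (a w)) < Suc (hcol G \<phi> (a w) (b w)))"
      by measurable
  qed
  show ?thesis unfolding edge_rel_def by measurable
qed

lemma measurable_edge_code [measurable (raw)]:
  assumes [measurable]: "a \<in> N \<rightarrow>\<^sub>M M" "b \<in> N \<rightarrow>\<^sub>M M"
  shows "(\<lambda>w. edge_code \<phi> (a w) (b w) i) \<in> N \<rightarrow>\<^sub>M count_space UNIV"
proof (cases "fst (prod_decode i) = 0")
  case True
  then show ?thesis unfolding edge_code_def merge_def by simp
next
  case False
  then show ?thesis unfolding edge_code_def merge_def by simp
qed

lemma pred_least_edge [measurable (raw)]:
  assumes [measurable]: "a \<in> N \<rightarrow>\<^sub>M M" "b \<in> N \<rightarrow>\<^sub>M M"
  shows "Measurable.pred N (\<lambda>w. least_edge G \<phi> (a w) (b w))"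
  unfolding least_edge_def
proof (intro pred_cls_all assms(1))
  fix m n
  have u [measurable]: "(\<lambda>w. f m (a w)) \<in> N \<rightarrow>\<^sub>M M" and v [measurable]: "(\<lambda>w. f n (a w)) \<in> N \<rightarrow>\<^sub>M M"
    by measurable
  have [measurable]: "Measurable.pred N (\<lambda>w. edge_code \<phi> (f m (a w)) (f n (a w)) i = edge_code \<phi> (a w) (b w) i)"
    "Measurable.pred N (\<lambda>w. edge_code \<phi> (f m (a w)) (f n (a w)) i < edge_code \<phi> (a w) (b w) i)" for i
    by (intro pred_nat_eq pred_nat_less measurable_edge_code u v assms)+
  show "Measurable.pred N (\<lambda>w. edge_rel G (hcol G \<phi>) (a w) (b w) (f m (a w)) (f n (a w)) \<longrightarrow>
      \<not> lexless (edge_code \<phi> (f m (a w)) (f n (a w))) (edge_code \<phi> (a w) (b w)))"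
    unfolding lexless_def by measurable
qed

lemma chosen_graph_sets: "chosen_graph G (least_edge G \<phi>) \<in> sets (M \<Otimes>\<^sub>M M)"
proof -
  have "chosen_graph G (least_edge G \<phi>) =
      {p \<in> space (M \<Otimes>\<^sub>M M). (fst p, snd p) \<in> G \<and> (least_edge G \<phi> (fst p) (snd p) \<or> least_edge G \<phi> (snd p) (fst p))}"
    using sets.sets_into_space[OF G_sets] by (auto simp: chosen_graph_def)
  also have "\<dots> \<in> sets (M \<Otimes>\<^sub>M M)" by measurable
  finally show ?thesis .
qed

end

section \<open>Borel median graphings with finite hyperplanes\<close>

context sym_graph
begin

text \<open>A path starting in a class never leaves it. Hence distances and intervals of a component
  agree with those of \<open>G\<close>, which links the notions defined per component to the global
  ones.\<close>

lemma relpow_Restr_cls: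
  assumes "x \<in> cls G w"
  shows "(x, y) \<in> (Restr G (cls G w)) ^^ n \<longleftrightarrow> (x, y) \<in> G ^^ n"
proof (induction n arbitrary: y)
  case (Suc n)
  have "z \<in> cls G w" if "(x, z) \<in> G ^^ n" for z
    using that assms by (auto simp: cls_def dest: relpow_imp_rtrancl intro: rtrancl_trans)
  then have "(x, z) \<in> G ^^ n \<Longrightarrow> (z, y) \<in> G \<Longrightarrow> z \<in> cls G w \<and> y \<in> cls G w" for z
    using cls_step by blast
  then show ?case unfolding relpow.simps relcomp_unfold mem_Collect_eq prod.case Suc by blast
qed simp

lemma path_dist_Restr_cls:
  "x \<in> cls G w \<Longrightarrow> path_dist (Restr G (cls G w)) x y = path_dist G x y"
  using relpow_Restr_cls by (simp add: path_dist_def)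

lemma interval_in_Restr_cls:
  "x \<in> cls G w \<Longrightarrow> interval_in (cls G w) (Restr G (cls G w)) x y = {z \<in> cls G w. between G x z y}"
  using path_dist_Restr_cls by (auto simp: interval_in_def between_def)

lemma cls_in_components:
  assumes "G \<subseteq> X \<times> X" "x \<in> X"
  shows "cls G x \<in> components X G"
proof -
  have "y \<in> X" if "(x, y) \<in> G\<^sup>*" for y
    using that by induction (use assms in auto)
  then have "cls G x = connectedness X G `` {x}"
    using assms(2) by (auto simp: cls_def connectedness_def)
  then show ?thesis using assms(2) by (auto simp: components_def quotient_def)
qed

lemma componentwise_medianI:
  assumes GX: "G \<subseteq> X \<times> X" and med: "\<And>C. C \<in> components X G \<Longrightarrow> median_graph C (Restr G C)"
  shows "componentwise_median G"
proof
  fix x y z assume y: "y \<in> cls G x" and z: "z \<in> cls G x"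
  show "\<exists>!m. m \<in> cls G x \<and> between G x m y \<and> between G y m z \<and> between G z m x"
  proof (cases "x \<in> X")
    case True
    define C where "C = cls G x"
    have "median_graph C (Restr G C)" unfolding C_def by (rule med[OF cls_in_components[OF GX True]])
    moreover have "x \<in> C" "y \<in> C" "z \<in> C" using y z by (simp_all add: C_def)
    ultimately have "is_singleton (interval_in C (Restr G C) x y \<inter> interval_in C (Restr G C) y z \<inter>
        interval_in C (Restr G C) z x)"
      unfolding median_graph_def by blast
    then obtain m where m: "{m} = {m \<in> C. between G x m y} \<inter> {m \<in> C. between G y m z} \<inter> {m \<in> C. between G z m x}"
      unfolding C_def interval_in_Restr_cls[OF cls_refl] interval_in_Restr_cls[OF y]
        interval_in_Restr_cls[OF z] is_singleton_def by auto
    have "k \<in> cls G x \<and> between G x k y \<and> between G y k z \<and> between G z k x \<longleftrightarrow> k = m" for k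
      using arg_cong[OF m, of "\<lambda>S. k \<in> S"] by (auto simp: C_def)
    then show ?thesis by (simp only: ex1_eq)
  next
    case False
    \<comment> \<open>Points outside \<open>X\<close> carry no edges, so their classes are trivially
      median.\<close>
    then have "cls G x = {x}" using GX by (auto simp: cls_def elim: converse_rtranclE)
    then show ?thesis using y z by (auto simp: between_def)
  qed
qed

end

context componentwise_median
begin

text \<open>Through this the assumption on \<open>hyperplanes\<close> becomes available for
  hyperplanes represented by an edge.\<close>

lemma half_space_side:
  assumes xy: "(x, y) \<in> G"
  shows "half_space (cls G x) (Restr G (cls G x)) {z \<in> cls G x. side G x y z}"
proof -
  have "c \<in> {z \<in> cls G x. side G x y z}"
    if "a \<in> {z \<in> cls G x. side G x y z}" "b \<in> {z \<in> cls G x. side G x y z}"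
      "c \<in> interval_in (cls G x) (Restr G (cls G x)) a b" for a b c
    using side_convex[OF xy, of a b c] that interval_in_Restr_cls[of a x b] by auto
  moreover have "c \<in> cls G x - {z \<in> cls G x. side G x y z}"
    if "a \<in> cls G x - {z \<in> cls G x. side G x y z}" "b \<in> cls G x - {z \<in> cls G x. side G x y z}"
      "c \<in> interval_in (cls G x) (Restr G (cls G x)) a b" for a b c
    using not_side_convex[OF xy, of a b c] that interval_in_Restr_cls[of a x b] by auto
  ultimately show ?thesis unfolding half_space_def convex_in_def by blast
qed

lemma finite_hyperplane_medianI:
  assumes GX: "G \<subseteq> X \<times> X" and fin: "finite_hyperplanes X G"
  shows "finite_hyperplane_median G"
proof
  fix x y assume xy: "(x, y) \<in> G"
  let ?C = "cls G x" and ?H = "{z \<in> cls G x. side G x y z}"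
  have "?C \<in> components X G" by (rule cls_in_components[OF GX]) (use xy GX in auto)
  moreover have "y \<in> ?H" "x \<in> ?C" "x \<notin> ?H" using side_edge[OF xy] edge_cls[OF xy] by auto
  then have "?H \<noteq> {}" "?H \<noteq> ?C" by blast+
  then have "{(u, v) \<in> Restr G ?C. u \<notin> ?H \<and> v \<in> ?H} \<in> hyperplanes ?C (Restr G ?C)"
    unfolding hyperplanes_def using half_space_side[OF xy] by blast
  ultimately have "finite {(u, v) \<in> Restr G ?C. u \<notin> ?H \<and> v \<in> ?H}"
    using fin unfolding finite_hyperplanes_def by blast
  moreover have "{(u, v) \<in> G. u \<in> ?C \<and> \<not> side G x y u \<and> side G x y v} \<subseteq> {(u, v) \<in> Restr G ?C. u \<notin> ?H \<and> v \<in> ?H}"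
    using cls_step by auto
  ultimately show "finite {(u, v) \<in> G. u \<in> ?C \<and> \<not> side G x y u \<and> side G x y v}" by (rule rev_finite_subset)
qed

end

theorem theorem1p8:
  fixes M :: "'a measure" and E G :: "('a \<times> 'a) set"
  assumes "standard_borel_space M"
    and "cber M E"
    and "median_graphing M E G"
    and "finite_hyperplanes (space M) G"
  shows "\<exists>T. T \<subseteq> G \<and> borel_graphing M E T \<and> acyclic_graph T"
proof (cases "space M = {}")
  case True
  \<comment> \<open>The coding maps the Baire space into \<open>space M\<close>, which therefore
    must have a point; the empty space is treated apart.\<close>
  have "G = {}" using assms(3) True
    by (auto simp: median_graphing_def borel_graphing_def borel_graph_def graph_on_def)
  moreover have "\<not> graph_cycle {} p" for p :: "'a list"
    by (auto simp: graph_cycle_def intro!: exI[of _ 0])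
  ultimately show ?thesis using assms(3)
    by (intro exI[of _ "{}"]) (auto simp: median_graphing_def acyclic_graph_def)
next
  case False
  have G: "G \<subseteq> space M \<times> space M" "sym G" "irrefl G" "G \<in> sets (M \<Otimes>\<^sub>M M)"
    and conn: "connectedness (space M) G = E"
    and med: "\<And>C. C \<in> components (space M) G \<Longrightarrow> median_graph C (Restr G C)"
    using assms(3) by (auto simp: median_graphing_def borel_graphing_def borel_graph_def graph_on_def)
  interpret sym_graph G by unfold_locales (fact G)+
  interpret componentwise_median G by (rule componentwise_medianI[OF G(1) med])
  interpret finite_hyperplane_median G by (rule finite_hyperplane_medianI[OF G(1) assms(4)])
  obtain \<phi> \<psi> where \<phi>: "\<phi> \<in> M \<rightarrow>\<^sub>M (borel :: baire measure)" and inv: "\<And>x. x \<in> space M \<Longrightarrow> \<psi> (\<phi> x) = x"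
    using standard_borel_coding[OF assms(1) False] by metis
  have inj: "inj_on \<phi> (space M)" by (rule inj_on_inverseI[where g = \<psi>]) (rule inv)
  have "Field G \<subseteq> space M" using G(1) by (auto simp: Field_def)
  then interpret coded_median G \<phi> by unfold_locales (rule inj_on_subset[OF inj])
  interpret tree_choice G "hcol G \<phi>" "least_edge G \<phi>" by (rule tree_choice_least_edge)
  have E: "equiv (space M) E" "E \<in> sets (M \<Otimes>\<^sub>M M)" "\<And>C. C \<in> space M // E \<Longrightarrow> countable C"
    using assms(2) by (auto simp: cber_def)
  have sect: "{y. (x, y) \<in> E} = cls G x" if "x \<in> space M" for x
  proof -
    have "y \<in> space M" if "(x, y) \<in> G\<^sup>*" for y
      using that by induction (use \<open>x \<in> space M\<close> G(1) in auto)
    then show ?thesis using that unfolding conn[symmetric] by (auto simp: connectedness_def cls_def)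
  qed
  have "countable {y. (x, y) \<in> E}" if "x \<in> space M" for x
    using E(3)[OF quotientI[OF that]] by (simp add: Image_singleton)
  from lusin_novikov[OF assms(1) E(2) this] obtain f :: "nat \<Rightarrow> 'a \<Rightarrow> 'a" where
    f: "\<And>n. f n \<in> M \<rightarrow>\<^sub>M M" and fE: "\<And>x y. (x, y) \<in> E \<Longrightarrow> \<exists>n. y = f n x"
    by metis
  \<comment> \<open>The covering functions may leave the class of \<open>x\<close>; the default
    \<open>x\<close> keeps them inside without losing a member, so they enumerate the class
    exactly.\<close>
  define f' where "f' n x = (if (x, f n x) \<in> E then f n x else x)" for n x
  interpret borel_graph_enum M G f' \<phi>
  proof
    note f[measurable] E(2)[measurable]
    show "f' n \<in> M \<rightarrow>\<^sub>M M" for n unfolding f'_def by measurable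
    show "cls G x = range (\<lambda>n. f' n x)" if x: "x \<in> space M" for x
    proof
      show "cls G x \<subseteq> range (\<lambda>n. f' n x)"
      proof
        fix y assume "y \<in> cls G x"
        then have "(x, y) \<in> E" using sect[OF x] by blast
        moreover from fE[OF this] obtain n where "y = f n x" ..
        ultimately have "y = f' n x" by (simp add: f'_def)
        then show "y \<in> range (\<lambda>n. f' n x)" by blast
      qed
      show "range (\<lambda>n. f' n x) \<subseteq> cls G x"
      proof clarify
        fix n
        have "f n x \<in> cls G x" if "(x, f n x) \<in> E" using that sect[OF x] by blast
        then show "f' n x \<in> cls G x" by (simp add: f'_def)
      qed
    qed
  qed (fact G(4) \<phi> inj)+
  have sub: "T \<subseteq> G" by (auto simp: chosen_graph_def)
  have "graph_on (space M) T"
    using sub G(1,3) sym_T by (auto simp: graph_on_def irrefl_def)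
  moreover have "connectedness (space M) T = E"
    unfolding conn[symmetric] connectedness_def connected_T ..
  ultimately have "borel_graphing M E T"
    using chosen_graph_sets by (simp add: borel_graphing_def borel_graph_def)
  then show ?thesis using sub acyclic_T by blast
qed

end
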